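(* Let $E\in\mathbb{C}^{n\times n}$, $F\in\mathbb{C}^{m\times n}$, let $G\in\mathbb{C}^{m\times m}$ be Hermitian, $q\in\mathbb{C}^n$, $r\in\mathbb{C}^m$, with $\begin{bmatrix}E&F^*\\ F&G\end{bmatrix}$ nonsingular, let $\alpha_1,\alpha_2,\alpha_3,\beta_1,\beta_2>0$, and let $\widehat{x}=[\widehat u^{T},\widehat p^{T}]^{T}$ with $\widehat u\in\mathbb{C}^n$, $\widehat p\in\mathbb{C}^m$ be a computed (approximate) solution of $\begin{bmatrix}E&F^*\\ F&G\end{bmatrix}\begin{bmatrix}u\\ p\end{bmatrix}=\begin{bmatrix}q\\ r\end{bmatrix}$. Put $Q=q-E\widehat u-F^*\widehat p$, $R=r-F\widehat u-G\widehat p$, $\mathcal{I}_1=[-\beta_1^{-1}I_{2n}\;\;0_{2n\times 2m}]$, $\mathcal{I}_2=[0_{2m\times 2n}\;\;-\beta_2^{-1}I_{2m}]$, $\mathbf{K}_1=[\widehat{\mathbf{K}}_1\;\;0_{2n\times m^2}]$, $\mathbf{K}_2=[0_{2m\times 2n^2}\;\;\widehat{\mathbf{K}}_2]$, where $$\widehat{\mathbf{K}}_1=\begin{bmatrix}\alpha_1^{-1}(\Re(\widehat u)^T\otimes I_n)\Sigma_E&-\alpha_1^{-1}(\Im(\widehat u)^T\otimes I_n)\Sigma_E&\alpha_2^{-1}(I_n\otimes\Re(\widehat p)^T)\Sigma_F&\alpha_2^{-1}(I_n\otimes\Im(\widehat p)^T)\Sigma_F\\ \alpha_1^{-1}(\Im(\widehat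 u)^T\otimes I_n)\Sigma_E&\alpha_1^{-1}(\Re(\widehat u)^T\otimes I_n)\Sigma_E&\alpha_2^{-1}(I_n\otimes\Im(\widehat p)^T)\Sigma_F&-\alpha_2^{-1}(I_n\otimes\Re(\widehat p)^T)\Sigma_F\end{bmatrix},$$ $$\widehat{\mathbf{K}}_2=\begin{bmatrix}\alpha_2^{-1}(\Re(\widehat u)^T\otimes I_m)\Sigma_F&-\alpha_2^{-1}(\Im(\widehat u)^T\otimes I_m)\Sigma_F&\alpha_3^{-1}(\Re(\widehat p)^T\otimes I_m)S_1&-\alpha_3^{-1}(\Im(\widehat p)^T\otimes I_m)S_2\\ \alpha_2^{-1}(\Im(\widehat u)^T\otimes I_m)\Sigma_F&\alpha_2^{-1}(\Re(\widehat u)^T\otimes I_m)\Sigma_F&\alpha_3^{-1}(\Im(\widehat p)^T\otimes I_m)S_1&\alpha_3^{-1}(\Re(\widehat p)^T\otimes I_m)S_2\end{bmatrix}.$$ Then the sparsity-preserving structured backward error is $$\xi^{\mathcal{G}_2}_{\rm sps}(\widehat u,\widehat p)=\left\|\begin{bmatrix}\mathbf{K}_1&\mathcal{I}_1\\ \mathbf{K}_2&\mathcal{I}_2\end{bmatrix}^T\left(\begin{bmatrix}\mathbf{K}_1&\mathcal{I}_1\\ \mathbf{K}_2&\mathcal{I}_2\end{bmatrix}\begin{bmatrix}\mathbf{K}_1&\mathcal{I}_1\\ \mathbf{K}_2&\mathcal{I}_2\end{bmatrix}^T\right)^{-1}\begin{bmatrix}\Re(Q)\\ \Im(Q)\\ \Re(R)\\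 \Im(R)\end{bmatrix}\right\|_2 .$$
   Context: Notation. $\Re,\Im$ are entrywise real and imaginary parts, $T$ is transpose, $*$ is conjugate transpose, $\otimes$ is the Kronecker product, $\odot$ the entrywise product, and $\mathrm{vec}$ stacks columns. For a matrix $X$, $\Theta_X$ is the matrix of the same size with entry $1$ where $X$ has a nonzero entry and $0$ where $X$ has a zero entry; $\Sigma_X=\mathrm{diag}(\mathrm{vec}(\Theta_X))$. For a real symmetric $k\times k$ matrix $Z$, $\mathrm{vec}_S(Z)\in\mathbb{R}^{k(k+1)/2}$ stacks the columns of the lower triangle including the diagonal: $(z_{11},\dots,z_{k1},z_{22},\dots,z_{k2},\dots,z_{kk})^T$. For a real skew-symmetric $Z$, $\mathrm{vec}_{SK}(Z)\in\mathbb{R}^{k(k-1)/2}$ stacks the columns of the strict lower triangle: $(z_{21},\dots,z_{k1},z_{32},\dots,z_{k2},\dots,z_{k(k-1)})^T$. $\mathcal{J}^k_S\in\mathbb{R}^{k^2\times k(k+1)/2}$ and $\mathcal{J}^k_{SK}\in\mathbb{R}^{k^2\times k(k-1)/2}$ are the matrices with $\mathrm{vec}(Z)=\mathcal{J}^k_S\mathrm{vec}_S(Z)$ for all real symmetric $Z$ and $\mathrm{vec}(Z)=\mathcal{J}^k_{SK}\mathrm{vec}_{SK}(Z)$ for all real skew-symmetric $Z$. For Hermitian $X$ of size $k$, $\Phi_X=\mathrm{diag}(\mathrm{vec}_S(\Theta_X))$ and $\Psi_X$ is the diagonal matrix whose diagonal is $(\Theta_X(1,2),\dots,\Theta_X(1,k),\Theta_X(2,3),\dots,\Theta_X(2,k),\dots,\Theta_X(k-1,k))$.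 $\mathfrak{D}_{S,k}$ is the diagonal matrix of size $k(k+1)/2$ with entry $1$ at the positions that $\mathrm{vec}_S$ assigns to diagonal entries, i.e. $j=\frac{(2k-(i-2))(i-1)}{2}+1$, $i=1,\dots,k$, and $\sqrt2$ at all other positions; $\mathfrak{D}_{SK,k}=\sqrt2\,I_{k(k-1)/2}$. Set $S_1=\mathcal{J}^m_S\Phi_G\mathfrak{D}_{S,m}^{-1}$, $S_2=\mathcal{J}^m_{SK}\Psi_G\mathfrak{D}_{SK,m}^{-1}$. Structured backward error. $\mathcal{G}_2$ is the set of tuples $(\Delta E,\Delta F,\Delta G,\Delta q,\Delta r)$ with $\Delta E\in\mathbb{C}^{n\times n}$, $\Delta F\in\mathbb{C}^{m\times n}$, $\Delta G\in\mathbb{C}^{m\times m}$ Hermitian, $\Delta q\in\mathbb{C}^n$, $\Delta r\in\mathbb{C}^m$ such that $$\begin{bmatrix}E+\Delta E&(F+\Delta F)^*\\ F+\Delta F&G+\Delta G\end{bmatrix}\begin{bmatrix}\widehat u\\ \widehat p\end{bmatrix}=\begin{bmatrix}q+\Delta q\\ r+\Delta r\end{bmatrix}.$$ Let $\zeta^{\sigma_1}(\Delta E,\Delta F,\Delta G,\Delta q,\Delta r)=\sqrt{\alpha_1^2\|\Delta E\|_F^2+\alpha_2^2\|\Delta F\|_F^2+\alpha_3^2\|\Delta G\|_F^2+\beta_1^2\|\Delta q\|_2^2+\beta_2^2\|\Delta r\|_2^2}$ ($\|\cdot\|_F$ the Frobenius norm). The sparsity-preserving structured backward error $\xi^{\mathcal{G}_2}_{\rm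 sps}(\widehat u,\widehat p)$ is the minimum of $\zeta^{\sigma_1}(\Delta E\odot\Theta_E,\Delta F\odot\Theta_F,\Delta G\odot\Theta_G,\Delta q,\Delta r)$ over all perturbations with $(\Delta E\odot\Theta_E,\Delta F\odot\Theta_F,\Delta G\odot\Theta_G,\Delta q,\Delta r)\in\mathcal{G}_2$. *)

theory Defs
  imports
    "Jordan_Normal_Form.Matrix"
    "Jordan_Normal_Form.Gauss_Jordan_Elimination"
    "Jordan_Normal_Form.Schur_Decomposition"
begin

text \<open>Rows and columns are numbered from 0 throughout, as in \<open>Jordan_Normal_Form\<close>.\<close>

section \<open>Matrix operations\<close>

definition append_cols :: "'a::zero mat \<Rightarrow> 'a mat \<Rightarrow> 'a mat" (infixr \<open>@\<^sub>c\<close> 66) where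
  "A @\<^sub>c B = four_block_mat A B (0\<^sub>m 0 (dim_col A)) (0\<^sub>m 0 (dim_col B))"

definition kronecker :: "'a::times mat \<Rightarrow> 'a mat \<Rightarrow> 'a mat" (infixl \<open>\<otimes>\<^sub>k\<close> 72) where
  "A \<otimes>\<^sub>k B = mat (dim_row A * dim_row B) (dim_col A * dim_col B)
     (\<lambda>(i, j). A $$ (i div dim_row B, j div dim_col B) * B $$ (i mod dim_row B, j mod dim_col B))"

definition hadamard :: "'a::times mat \<Rightarrow> 'a mat \<Rightarrow> 'a mat" (infixl \<open>\<odot>\<^sub>m\<close> 70) where
  "A \<odot>\<^sub>m B = mat (dim_row A) (dim_col A) (\<lambda>ij. A $$ ij * B $$ ij)"

text \<open>Column stacking: entry \<open>(i, j)\<close> goes to position \<open>i + j * dim_row X\<close>.\<close>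
definition vec_stack :: "'a mat \<Rightarrow> 'a vec" where
  "vec_stack X = vec (dim_row X * dim_col X) (\<lambda>p. X $$ (p mod dim_row X, p div dim_row X))"

definition diag_of_vec :: "'a::zero vec \<Rightarrow> 'a mat" where
  "diag_of_vec v = mat_diag (dim_vec v) (\<lambda>i. v $ i)"

definition hermitian_mat :: "complex mat \<Rightarrow> bool" where
  "hermitian_mat A \<longleftrightarrow> mat_adjoint A = A"

text \<open>Only meaningful for invertible matrices (otherwise it is an unspecified value).\<close>
definition inv_mat :: "'a::field mat \<Rightarrow> 'a mat" where
  "inv_mat A = the (mat_inverse A)"

definition frob_norm :: "'a::real_normed_vector mat \<Rightarrow> real" where
  "frob_norm A = sqrt (\<Sum>i<dim_row A. \<Sum>j<dim_col A. (norm (A $$ (i, j)))\<^sup>2)"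

definition norm2 :: "'a::real_normed_vector vec \<Rightarrow> real" where
  "norm2 v = sqrt (\<Sum>i<dim_vec v. (norm (v $ i))\<^sup>2)"

section \<open>Sparsity patterns\<close>

text \<open>The 0/1 pattern is needed both as a real and as a complex matrix, so the entry type of the
  result is left open.\<close>
definition Theta :: "'a::zero mat \<Rightarrow> 'b::zero_neq_one mat" where
  "Theta X = map_mat (\<lambda>x. if x = 0 then 0 else 1) X"

definition Sigma_mat :: "'a::zero mat \<Rightarrow> real mat" where
  "Sigma_mat X = diag_of_vec (vec_stack (Theta X))"

section \<open>Half-vectorizations of symmetric and skew-symmetric matrices\<close>

definition lower_pairs :: "nat \<Rightarrow> (nat \<times> nat) list" where
  "lower_pairs k = [(i, j). j \<leftarrow> [0..<k], i \<leftarrow> [j..<k]]"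

definition strict_lower_pairs :: "nat \<Rightarrow> (nat \<times> nat) list" where
  "strict_lower_pairs k = [(i, j). j \<leftarrow> [0..<k], i \<leftarrow> [Suc j..<k]]"

definition strict_upper_pairs :: "nat \<Rightarrow> (nat \<times> nat) list" where
  "strict_upper_pairs k = [(i, j). i \<leftarrow> [0..<k], j \<leftarrow> [Suc i..<k]]"

definition vec_S :: "'a mat \<Rightarrow> 'a vec" where
  "vec_S Z = vec_of_list (map (\<lambda>ij. Z $$ ij) (lower_pairs (dim_row Z)))"

definition vec_SK :: "'a mat \<Rightarrow> 'a vec" where
  "vec_SK Z = vec_of_list (map (\<lambda>ij. Z $$ ij) (strict_lower_pairs (dim_row Z)))"

definition J_S :: "nat \<Rightarrow> real mat" where
  "J_S k = (THE J. J \<in> carrier_mat (k\<^sup>2) (k * (k + 1) div 2) \<and>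
     (\<forall>Z \<in> carrier_mat k k. transpose_mat Z = Z \<longrightarrow> vec_stack Z = J *\<^sub>v vec_S Z))"

definition J_SK :: "nat \<Rightarrow> real mat" where
  "J_SK k = (THE J. J \<in> carrier_mat (k\<^sup>2) (k * (k - 1) div 2) \<and>
     (\<forall>Z \<in> carrier_mat k k. transpose_mat Z = - Z \<longrightarrow> vec_stack Z = J *\<^sub>v vec_SK Z))"

text \<open>Both descriptions above determine exactly one matrix: \<open>ex1_J_S\<close>, \<open>ex1_J_SK\<close>.\<close>

lemma ex1_selection_mat:
  fixes ps :: "(nat \<times> nat) list" and C :: "real mat set" and B :: "nat \<Rightarrow> real mat"
  defines "v \<equiv> \<lambda>Z. vec_of_list (map (\<lambda>ij. Z $$ ij) ps)"
  assumes C: "C \<subseteq> carrier_mat k k"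
    and B: "\<And>c. c < length ps \<Longrightarrow> B c \<in> C"
    and unit: "\<And>c. c < length ps \<Longrightarrow> v (B c) = unit_vec (length ps) c"
    and expand: "\<And>Z i j. Z \<in> C \<Longrightarrow> i < k \<Longrightarrow> j < k \<Longrightarrow>
                   Z $$ (i, j) = (\<Sum>c<length ps. B c $$ (i, j) * v Z $ c)"
  shows "\<exists>!J. J \<in> carrier_mat (k\<^sup>2) (length ps) \<and> (\<forall>Z\<in>C. vec_stack Z = J *\<^sub>v v Z)"
proof (rule ex1I)
  let ?N = "length ps"
  let ?J = "mat (k\<^sup>2) ?N (\<lambda>(x, c). vec_stack (B c) $ x)"
  have dv: "dim_vec (v Z) = ?N" for Z by (simp add: v_def)
  have "vec_stack Z = ?J *\<^sub>v v Z" if Z: "Z \<in> C" for Z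
  proof (rule eq_vecI)
    have Zc: "Z \<in> carrier_mat k k" using Z C by auto
    show "dim_vec (vec_stack Z) = dim_vec (?J *\<^sub>v v Z)"
      using Zc by (simp add: vec_stack_def power2_eq_square)
    fix x assume "x < dim_vec (?J *\<^sub>v v Z)"
    hence x: "x < k * k" by (simp add: power2_eq_square)
    hence k: "x mod k < k" "x div k < k"
      by (auto simp: less_mult_imp_div_less intro!: mod_less_divisor gr0I)
    have "vec_stack Z $ x = (\<Sum>c<?N. B c $$ (x mod k, x div k) * v Z $ c)"
      using expand[OF Z k] Zc x by (simp add: vec_stack_def)
    also have "\<dots> = (\<Sum>c<?N. vec_stack (B c) $ x * v Z $ c)"
    proof (rule sum.cong)
      fix c assume "c \<in> {..<?N}"
      hence "B c \<in> carrier_mat k k" using B C by auto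
      thus "B c $$ (x mod k, x div k) * v Z $ c = vec_stack (B c) $ x * v Z $ c"
        using x by (simp add: vec_stack_def)
    qed simp
    also have "\<dots> = (?J *\<^sub>v v Z) $ x"
      using x by (simp add: scalar_prod_def dv power2_eq_square atLeast0LessThan)
    finally show "vec_stack Z $ x = (?J *\<^sub>v v Z) $ x" .
  qed
  thus "?J \<in> carrier_mat (k\<^sup>2) ?N \<and> (\<forall>Z\<in>C. vec_stack Z = ?J *\<^sub>v v Z)" by auto
  fix J assume J: "J \<in> carrier_mat (k\<^sup>2) ?N \<and> (\<forall>Z\<in>C. vec_stack Z = J *\<^sub>v v Z)"
  show "J = ?J"
  proof (rule eq_matI)
    fix x c assume "x < dim_row ?J" "c < dim_col ?J"
    hence x: "x < k\<^sup>2" and c: "c < ?N" by auto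
    have "vec_stack (B c) = J *\<^sub>v unit_vec ?N c" using J B[OF c] unit[OF c] by auto
    also have "\<dots> = col J c" using J c by (intro eq_vecI) auto
    finally show "J $$ (x, c) = ?J $$ (x, c)" using J x c by auto
  qed (use J in auto)
qed

lemma length_lower_pairs: "length (lower_pairs k) = k * (k + 1) div 2"
proof -
  have "length (lower_pairs k) = (\<Sum>j<k. k - j)"
    by (simp add: lower_pairs_def length_concat o_def interv_sum_list_conv_sum_set_nat atLeast0LessThan)
  also have "\<dots> = (\<Sum>j<k. Suc j)"
    by (rule sum.reindex_bij_witness[where i = "\<lambda>j. k - Suc j" and j = "\<lambda>j. k - Suc j"]) auto
  also have "\<dots> = k * (k + 1) div 2"
    by (induction k) auto
  finally show ?thesis .
qed

lemma length_strict_lower_pairs: "length (strict_lower_pairs k) = k * (k - 1) div 2"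
proof -
  have "length (strict_lower_pairs k) = (\<Sum>j<k. k - Suc j)"
    by (simp add: strict_lower_pairs_def length_concat o_def interv_sum_list_conv_sum_set_nat atLeast0LessThan)
  also have "\<dots> = (\<Sum>j<k. j)"
    by (rule sum.reindex_bij_witness[where i = "\<lambda>j. k - Suc j" and j = "\<lambda>j. k - Suc j"]) auto
  also have "\<dots> = k * (k - 1) div 2"
    using Sum_Ico_nat[of 0 k] by (simp add: atLeast0LessThan)
  finally show ?thesis .
qed

lemma distinct_pair_list:
  "distinct js \<Longrightarrow> distinct [(i, j). j \<leftarrow> js, i \<leftarrow> [f j..<k]]"
  by (induction js) (auto simp: distinct_map inj_on_def)

lemma set_lower_pairs: "set (lower_pairs k) = {(i, j). j \<le> i \<and> i < k}"
  by (force simp: lower_pairs_def)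

lemma set_strict_lower_pairs: "set (strict_lower_pairs k) = {(i, j). j < i \<and> i < k}"
  by (force simp: strict_lower_pairs_def)

lemma distinct_lower_pairs: "distinct (lower_pairs k)"
  unfolding lower_pairs_def by (rule distinct_pair_list) simp

lemma distinct_strict_lower_pairs: "distinct (strict_lower_pairs k)"
  unfolding strict_lower_pairs_def by (rule distinct_pair_list) simp

lemma nth_eq_delta:
  assumes "distinct ps" "c < length ps" "d < length ps"
  shows "(ps ! d = ps ! c) = (d = c)"
  using assms by (auto simp: nth_eq_iff_index_eq)

lemma ex1_J_S:
  "\<exists>!J::real mat. J \<in> carrier_mat (k\<^sup>2) (k * (k + 1) div 2) \<and>
     (\<forall>Z \<in> carrier_mat k k. transpose_mat Z = Z \<longrightarrow> vec_stack Z = J *\<^sub>v vec_S Z)"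
proof -
  let ?ps = "lower_pairs k"
  let ?C = "{Z :: real mat. Z \<in> carrier_mat k k \<and> transpose_mat Z = Z}"
  let ?B = "\<lambda>c. mat k k (\<lambda>(i, j). if (i, j) = ?ps ! c \<or> (j, i) = ?ps ! c then 1 else 0) :: real mat"
  let ?v = "\<lambda>Z :: real mat. vec_of_list (map (\<lambda>ij. Z $$ ij) ?ps)"
  have in_ps: "?ps ! d \<in> {(i, j). j \<le> i \<and> i < k}" if "d < length ?ps" for d
    using nth_mem[OF that] unfolding set_lower_pairs .
  have "\<exists>!J. J \<in> carrier_mat (k\<^sup>2) (length ?ps) \<and> (\<forall>Z\<in>?C. vec_stack Z = J *\<^sub>v ?v Z)"
  proof (rule ex1_selection_mat[where B = ?B])
    show "?C \<subseteq> carrier_mat k k" by auto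
    show "?B c \<in> ?C" for c by auto
  next
    fix c assume c: "c < length ?ps"
    show "?v (?B c) = unit_vec (length ?ps) c"
    proof (rule eq_vecI)
      fix d assume "d < dim_vec (unit_vec (length ?ps) c :: real vec)"
      hence d: "d < length ?ps" by simp
      obtain a b where ab: "?ps ! c = (a, b)" "b \<le> a" "a < k" using in_ps[OF c] by auto
      obtain i j where ij: "?ps ! d = (i, j)" "j \<le> i" "i < k" using in_ps[OF d] by auto
      have "(d = c) = ((i, j) = (a, b))"
        using nth_eq_delta[OF distinct_lower_pairs c d] ab ij by simp
      thus "?v (?B c) $ d = unit_vec (length ?ps) c $ d"
        using d c ab ij by (auto simp: vec_of_list_index)
    qed simp
  next
    fix Z :: "real mat" and i j assume Z: "Z \<in> ?C" and i: "i < k" and j: "j < k"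
    have Zc: "Z \<in> carrier_mat k k" and Zt: "transpose_mat Z = Z" using Z by auto
    have sym: "Z $$ (j, i) = Z $$ (i, j)"
      using index_transpose_mat(1)[of i Z j] Zc i j unfolding Zt by simp
    have "(max i j, min i j) \<in> set ?ps" using i j by (auto simp: set_lower_pairs)
    then obtain d where d: "d < length ?ps" "?ps ! d = (max i j, min i j)"
      by (auto simp: in_set_conv_nth)
    have "?B c $$ (i, j) = (if c = d then 1 else 0)" if c: "c < length ?ps" for c
    proof -
      obtain a b where ab: "?ps ! c = (a, b)" "b \<le> a" "a < k" using in_ps[OF c] by auto
      have "(c = d) = ((a, b) = (max i j, min i j))"
        using nth_eq_delta[OF distinct_lower_pairs d(1) c] ab d by simp
      moreover have "?B c $$ (i, j) = (if (i, j) = (a, b) \<or> (j, i) = (a, b) then 1 else 0)"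
        using ab(1) i j by simp
      moreover have "((i, j) = (a, b) \<or> (j, i) = (a, b)) = ((a, b) = (max i j, min i j))"
        using ab(2) by (cases "i \<le> j") auto
      ultimately show ?thesis by presburger
    qed
    hence "(\<Sum>c<length ?ps. ?B c $$ (i, j) * ?v Z $ c)
             = (\<Sum>c<length ?ps. if c = d then ?v Z $ c else 0)"
      by (intro sum.cong) auto
    also have "\<dots> = Z $$ (max i j, min i j)" using d by (simp add: vec_of_list_index)
    also have "\<dots> = Z $$ (i, j)" using sym by (auto simp: max_def min_def)
    finally show "Z $$ (i, j) = (\<Sum>c<length ?ps. ?B c $$ (i, j) * ?v Z $ c)" ..
  qed
  moreover have "(\<forall>Z\<in>?C. vec_stack Z = J *\<^sub>v ?v Z) \<longleftrightarrow>
     (\<forall>Z \<in> carrier_mat k k. transpose_mat Z = Z \<longrightarrow> vec_stack Z = J *\<^sub>v vec_S Z)" for J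
    by (auto simp: vec_S_def)
  ultimately show ?thesis unfolding length_lower_pairs by simp
qed

lemma ex1_J_SK:
  "\<exists>!J::real mat. J \<in> carrier_mat (k\<^sup>2) (k * (k - 1) div 2) \<and>
     (\<forall>Z \<in> carrier_mat k k. transpose_mat Z = - Z \<longrightarrow> vec_stack Z = J *\<^sub>v vec_SK Z)"
proof -
  let ?ps = "strict_lower_pairs k"
  let ?C = "{Z :: real mat. Z \<in> carrier_mat k k \<and> transpose_mat Z = - Z}"
  let ?B = "\<lambda>c. mat k k (\<lambda>(i, j). if (i, j) = ?ps ! c then 1
                                 else if (j, i) = ?ps ! c then -1 else 0) :: real mat"
  let ?v = "\<lambda>Z :: real mat. vec_of_list (map (\<lambda>ij. Z $$ ij) ?ps)"
  have in_ps: "?ps ! d \<in> {(i, j). j < i \<and> i < k}" if "d < length ?ps" for d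
    using nth_mem[OF that] unfolding set_strict_lower_pairs .
  have "\<exists>!J. J \<in> carrier_mat (k\<^sup>2) (length ?ps) \<and> (\<forall>Z\<in>?C. vec_stack Z = J *\<^sub>v ?v Z)"
  proof (rule ex1_selection_mat[where B = ?B])
    show "?C \<subseteq> carrier_mat k k" by auto
  next
    fix c assume c: "c < length ?ps"
    obtain a b where ab: "?ps ! c = (a, b)" "b < a" "a < k" using in_ps[OF c] by auto
    show "?B c \<in> ?C" using ab by (auto intro!: eq_matI)
    show "?v (?B c) = unit_vec (length ?ps) c"
    proof (rule eq_vecI)
      fix d assume "d < dim_vec (unit_vec (length ?ps) c :: real vec)"
      hence d: "d < length ?ps" by simp
      obtain i j where ij: "?ps ! d = (i, j)" "j < i" "i < k" using in_ps[OF d] by auto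
      have "(d = c) = ((i, j) = (a, b))"
        using nth_eq_delta[OF distinct_strict_lower_pairs c d] ab ij by simp
      thus "?v (?B c) $ d = unit_vec (length ?ps) c $ d"
        using d c ab ij by (auto simp: vec_of_list_index)
    qed simp
  next
    fix Z :: "real mat" and i j assume Z: "Z \<in> ?C" and i: "i < k" and j: "j < k"
    have Zc: "Z \<in> carrier_mat k k" and Zt: "transpose_mat Z = - Z" using Z by auto
    have skew: "Z $$ (b, a) = - Z $$ (a, b)" if "a < k" "b < k" for a b
      using index_transpose_mat(1)[of a Z b] Zc that unfolding Zt by simp
    show "Z $$ (i, j) = (\<Sum>c<length ?ps. ?B c $$ (i, j) * ?v Z $ c)"
    proof (cases "i = j")
      case True
      have "?B c $$ (i, j) = 0" if c: "c < length ?ps" for c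
        using in_ps[OF c] i j True by auto
      moreover have "Z $$ (i, j) = 0" using skew[OF i j] True by simp
      ultimately show ?thesis by simp
    next
      case False
      hence "(max i j, min i j) \<in> set ?ps" using i j by (auto simp: set_strict_lower_pairs)
      then obtain d where d: "d < length ?ps" "?ps ! d = (max i j, min i j)"
        by (auto simp: in_set_conv_nth)
      have "?B c $$ (i, j) = (if c = d then if j < i then 1 else -1 else 0)"
        if c: "c < length ?ps" for c
      proof -
        obtain a b where ab: "?ps ! c = (a, b)" "b < a" "a < k" using in_ps[OF c] by auto
        have "(c = d) = ((a, b) = (max i j, min i j))"
          using nth_eq_delta[OF distinct_strict_lower_pairs d(1) c] ab d by simp
        moreover have "?B c $$ (i, j) =
            (if (i, j) = (a, b) then 1 else if (j, i) = (a, b) then -1 else 0)"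
          using ab(1) i j by simp
        moreover have "((i, j) = (a, b)) = (j < i \<and> (a, b) = (max i j, min i j))"
          using ab(2) by (cases "i \<le> j") auto
        moreover have "((j, i) = (a, b)) = (\<not> j < i \<and> (a, b) = (max i j, min i j))"
          using ab(2) False by (cases "i \<le> j") auto
        ultimately show ?thesis by presburger
      qed
      hence "(\<Sum>c<length ?ps. ?B c $$ (i, j) * ?v Z $ c)
               = (\<Sum>c<length ?ps. if c = d then (if j < i then 1 else -1) * ?v Z $ c else 0)"
        by (intro sum.cong) auto
      also have "\<dots> = (if j < i then 1 else -1) * Z $$ (max i j, min i j)"
        using d by (simp add: vec_of_list_index)
      also have "\<dots> = Z $$ (i, j)" using skew[OF i j] by (auto simp: max_def min_def)
      finally show ?thesis ..
    qed
  qed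
  moreover have "(\<forall>Z\<in>?C. vec_stack Z = J *\<^sub>v ?v Z) \<longleftrightarrow>
     (\<forall>Z \<in> carrier_mat k k. transpose_mat Z = - Z \<longrightarrow> vec_stack Z = J *\<^sub>v vec_SK Z)" for J
    by (auto simp: vec_SK_def)
  ultimately show ?thesis unfolding length_strict_lower_pairs by simp
qed

lemmas J_S_spec = theI'[OF ex1_J_S, folded J_S_def]
lemmas J_SK_spec = theI'[OF ex1_J_SK, folded J_SK_def]

definition Phi_mat :: "complex mat \<Rightarrow> real mat" where
  "Phi_mat X = diag_of_vec (vec_S (Theta X))"

definition Psi_mat :: "complex mat \<Rightarrow> real mat" where
  "Psi_mat X = diag_of_vec (vec_of_list (map (\<lambda>ij. Theta X $$ ij) (strict_upper_pairs (dim_row X))))"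

text \<open>With 1-based numbering the diagonal entries sit at positions
  \<open>(2k - (i - 2)) (i - 1) / 2 + 1\<close> for \<open>i = 1, ..., k\<close>; below, both \<open>i\<close> and the position are
  shifted down by one.\<close>
definition D_S :: "nat \<Rightarrow> real mat" where
  "D_S k = mat_diag (k * (k + 1) div 2)
     (\<lambda>p. if \<exists>i<k. p = (2 * k + 1 - i) * i div 2 then 1 else sqrt 2)"

definition D_SK :: "nat \<Rightarrow> real mat" where
  "D_SK k = sqrt 2 \<cdot>\<^sub>m 1\<^sub>m (k * (k - 1) div 2)"

definition S1_mat :: "complex mat \<Rightarrow> real mat" where
  "S1_mat G = J_S (dim_row G) * Phi_mat G * inv_mat (D_S (dim_row G))"

definition S2_mat :: "complex mat \<Rightarrow> real mat" where
  "S2_mat G = J_SK (dim_row G) * Psi_mat G * inv_mat (D_SK (dim_row G))"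

section \<open>Structured backward error\<close>

definition saddle_mat :: "complex mat \<Rightarrow> complex mat \<Rightarrow> complex mat \<Rightarrow> complex mat" where
  "saddle_mat E F G = four_block_mat E (mat_adjoint F) F G"

definition G2_set ::
  "nat \<Rightarrow> nat \<Rightarrow> complex mat \<Rightarrow> complex mat \<Rightarrow> complex mat \<Rightarrow> complex vec \<Rightarrow> complex vec \<Rightarrow>
   complex vec \<Rightarrow> complex vec \<Rightarrow>
   (complex mat \<times> complex mat \<times> complex mat \<times> complex vec \<times> complex vec) set" where
  "G2_set n m E F G q r u p = {(dE, dF, dG, dq, dr).
     dE \<in> carrier_mat n n \<and> dF \<in> carrier_mat m n \<and> dG \<in> carrier_mat m m \<and> hermitian_mat dG \<and>
     dq \<in> carrier_vec n \<and> dr \<in> carrier_vec m \<and>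
     saddle_mat (E + dE) (F + dF) (G + dG) *\<^sub>v (u @\<^sub>v p) = (q + dq) @\<^sub>v (r + dr)}"

definition zeta ::
  "real \<Rightarrow> real \<Rightarrow> real \<Rightarrow> real \<Rightarrow> real \<Rightarrow>
   complex mat \<Rightarrow> complex mat \<Rightarrow> complex mat \<Rightarrow> complex vec \<Rightarrow> complex vec \<Rightarrow> real" where
  "zeta \<alpha>1 \<alpha>2 \<alpha>3 \<beta>1 \<beta>2 dE dF dG dq dr =
     sqrt (\<alpha>1\<^sup>2 * (frob_norm dE)\<^sup>2 + \<alpha>2\<^sup>2 * (frob_norm dF)\<^sup>2 + \<alpha>3\<^sup>2 * (frob_norm dG)\<^sup>2
         + \<beta>1\<^sup>2 * (norm2 dq)\<^sup>2 + \<beta>2\<^sup>2 * (norm2 dr)\<^sup>2)"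

definition sps_values ::
  "nat \<Rightarrow> nat \<Rightarrow> real \<Rightarrow> real \<Rightarrow> real \<Rightarrow> real \<Rightarrow> real \<Rightarrow>
   complex mat \<Rightarrow> complex mat \<Rightarrow> complex mat \<Rightarrow> complex vec \<Rightarrow> complex vec \<Rightarrow>
   complex vec \<Rightarrow> complex vec \<Rightarrow> real set" where
  "sps_values n m \<alpha>1 \<alpha>2 \<alpha>3 \<beta>1 \<beta>2 E F G q r u p =
     {zeta \<alpha>1 \<alpha>2 \<alpha>3 \<beta>1 \<beta>2 (dE \<odot>\<^sub>m Theta E) (dF \<odot>\<^sub>m Theta F) (dG \<odot>\<^sub>m Theta G) dq dr | dE dF dG dq dr.
        (dE \<odot>\<^sub>m Theta E, dF \<odot>\<^sub>m Theta F, dG \<odot>\<^sub>m Theta G, dq, dr) \<in> G2_set n m E F G q r u p}"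

text \<open>The values are bounded below by 0, so the infimum is their minimum precisely when it is one
  of them; a statement about the minimum should therefore also assert membership in
  \<open>sps_values\<close>.\<close>
definition sps_error ::
  "nat \<Rightarrow> nat \<Rightarrow> real \<Rightarrow> real \<Rightarrow> real \<Rightarrow> real \<Rightarrow> real \<Rightarrow>
   complex mat \<Rightarrow> complex mat \<Rightarrow> complex mat \<Rightarrow> complex vec \<Rightarrow> complex vec \<Rightarrow>
   complex vec \<Rightarrow> complex vec \<Rightarrow> real" where
  "sps_error n m \<alpha>1 \<alpha>2 \<alpha>3 \<beta>1 \<beta>2 E F G q r u p =
     Inf (sps_values n m \<alpha>1 \<alpha>2 \<alpha>3 \<beta>1 \<beta>2 E F G q r u p)"

section \<open>The coefficient matrices\<close>

abbreviation Re_mat :: "complex mat \<Rightarrow> real mat" where "Re_mat \<equiv> map_mat Re"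
abbreviation Im_mat :: "complex mat \<Rightarrow> real mat" where "Im_mat \<equiv> map_mat Im"
abbreviation Re_vec :: "complex vec \<Rightarrow> real vec" where "Re_vec \<equiv> map_vec Re"
abbreviation Im_vec :: "complex vec \<Rightarrow> real vec" where "Im_vec \<equiv> map_vec Im"

text \<open>For a real vector \<open>v\<close>, the row matrix \<open>mat_of_row v\<close> plays the role of the transpose of the
  column \<open>v\<close>.\<close>
definition K1_hat :: "nat \<Rightarrow> real \<Rightarrow> real \<Rightarrow> complex mat \<Rightarrow> complex mat \<Rightarrow>
    complex vec \<Rightarrow> complex vec \<Rightarrow> real mat" where
  "K1_hat n \<alpha>1 \<alpha>2 E F u p =
    (let ru = mat_of_row (Re_vec u); iu = mat_of_row (Im_vec u);
         rp = mat_of_row (Re_vec p); ip = mat_of_row (Im_vec p);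
         I = 1\<^sub>m n
     in
     (inverse \<alpha>1 \<cdot>\<^sub>m ((ru \<otimes>\<^sub>k I) * Sigma_mat E) @\<^sub>c
      - (inverse \<alpha>1 \<cdot>\<^sub>m ((iu \<otimes>\<^sub>k I) * Sigma_mat E)) @\<^sub>c
      inverse \<alpha>2 \<cdot>\<^sub>m ((I \<otimes>\<^sub>k rp) * Sigma_mat F) @\<^sub>c
      inverse \<alpha>2 \<cdot>\<^sub>m ((I \<otimes>\<^sub>k ip) * Sigma_mat F))
     @\<^sub>r
     (inverse \<alpha>1 \<cdot>\<^sub>m ((iu \<otimes>\<^sub>k I) * Sigma_mat E) @\<^sub>c
      inverse \<alpha>1 \<cdot>\<^sub>m ((ru \<otimes>\<^sub>k I) * Sigma_mat E) @\<^sub>c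
      inverse \<alpha>2 \<cdot>\<^sub>m ((I \<otimes>\<^sub>k ip) * Sigma_mat F) @\<^sub>c
      - (inverse \<alpha>2 \<cdot>\<^sub>m ((I \<otimes>\<^sub>k rp) * Sigma_mat F))))"

definition K2_hat :: "nat \<Rightarrow> real \<Rightarrow> real \<Rightarrow> complex mat \<Rightarrow> complex mat \<Rightarrow>
    complex vec \<Rightarrow> complex vec \<Rightarrow> real mat" where
  "K2_hat m \<alpha>2 \<alpha>3 F G u p =
    (let ru = mat_of_row (Re_vec u); iu = mat_of_row (Im_vec u);
         rp = mat_of_row (Re_vec p); ip = mat_of_row (Im_vec p);
         I = 1\<^sub>m m
     in
     (inverse \<alpha>2 \<cdot>\<^sub>m ((ru \<otimes>\<^sub>k I) * Sigma_mat F) @\<^sub>c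
      - (inverse \<alpha>2 \<cdot>\<^sub>m ((iu \<otimes>\<^sub>k I) * Sigma_mat F)) @\<^sub>c
      inverse \<alpha>3 \<cdot>\<^sub>m ((rp \<otimes>\<^sub>k I) * S1_mat G) @\<^sub>c
      - (inverse \<alpha>3 \<cdot>\<^sub>m ((ip \<otimes>\<^sub>k I) * S2_mat G)))
     @\<^sub>r
     (inverse \<alpha>2 \<cdot>\<^sub>m ((iu \<otimes>\<^sub>k I) * Sigma_mat F) @\<^sub>c
      inverse \<alpha>2 \<cdot>\<^sub>m ((ru \<otimes>\<^sub>k I) * Sigma_mat F) @\<^sub>c
      inverse \<alpha>3 \<cdot>\<^sub>m ((ip \<otimes>\<^sub>k I) * S1_mat G) @\<^sub>c
      inverse \<alpha>3 \<cdot>\<^sub>m ((rp \<otimes>\<^sub>k I) * S2_mat G)))"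

end

theory Submission
  imports Defs
begin

text \<open>Weight each block of a perturbation by its coefficient, split it into real and imaginary part, and
  vectorize; for the Hermitian block the real part is symmetric and the imaginary part skew-symmetric, and
  the factors \<open>sqrt 2\<close> in the half-vectorizations account for the entries that occur twice. In these
  coordinates the objective is the Euclidean norm of the coordinate vector, and the perturbed system
  becomes the underdetermined real linear system with the coefficient matrix of the theorem. Its last
  \<open>2n + 2m\<close> columns are a nonsingular diagonal matrix, so it has full row rank and the backward error is
  the norm of the least-norm solution. That solution may be taken to respect the sparsity pattern because
  removing the entries outside the pattern changes no product and does not increase the norm.\<close>

section \<open>Least-norm solutions\<close>

text \<open>The map from coordinate vectors to perturbations is in general not injective, since
  \<open>Sigma_mat\<close>, \<open>Phi_mat\<close> and \<open>Psi_mat\<close> have zero diagonal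
  entries at the zeros of the data. So the two minimization problems are not simply isometric, and
  two inequalities are proved separately: every admissible perturbation has a coordinate vector of
  exactly its weighted norm, and every coordinate vector yields an admissible perturbation of at
  most its norm. Minimality of the least-norm solution closes the gap. Hermitian symmetry of
  \<open>G\<close> enters through its zero pattern, which is then symmetric; otherwise masking need
  not preserve symmetric or skew-symmetric matrices, and the diagonal of \<open>Psi_mat G\<close>,
  read off the upper triangle, need not fit the lower-triangle coordinates of \<open>vec_SK\<close>.
  The perturbation of \<open>F\<close> acts in both block rows, once as an adjoint; its coordinates
  are the columns that the two zero paddings leave in common.\<close>

lemma inv_mat:
  fixes A :: "'a::field mat"
  assumes A: "A \<in> carrier_mat n n" and "invertible_mat A"
  shows "inv_mat A \<in> carrier_mat n n" "A * inv_mat A = 1\<^sub>m n" "inv_mat A * A = 1\<^sub>m n"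
proof -
  obtain B where B: "A * B = 1\<^sub>m (dim_row A)" "B * A = 1\<^sub>m (dim_row B)"
    using assms by (auto simp: invertible_mat_def inverts_mat_def)
  \<comment> \<open>\<open>inverts_mat\<close> does not fix the size of \<open>B\<close>; comparing
    column counts in the two identities does.\<close>
  have "B \<in> carrier_mat n n"
    using A arg_cong[OF B(1), of dim_col] arg_cong[OF B(2), of dim_col] by auto
  hence "A \<in> Units (ring_mat TYPE('a) n ())"
    using A B by (auto simp: Units_def ring_mat_def)
  \<comment> \<open>\<open>mat_inverse\<close> returns \<open>None\<close> only outside the units of
    the matrix ring, so the \<open>the\<close> in \<open>inv_mat\<close> is applied to a genuine
    inverse.\<close>
  then obtain C where "mat_inverse A = Some C"
    using mat_inverse(1)[OF A, of "()"] by (cases "mat_inverse A") auto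
  thus "inv_mat A \<in> carrier_mat n n" "A * inv_mat A = 1\<^sub>m n" "inv_mat A * A = 1\<^sub>m n"
    using mat_inverse(2)[OF A] by (auto simp: inv_mat_def)
qed

lemma invertible_mat_if_kernel_trivial:
  fixes A :: "'a::field mat"
  assumes A: "A \<in> carrier_mat n n"
    and ker: "\<And>v. v \<in> carrier_vec n \<Longrightarrow> A *\<^sub>v v = 0\<^sub>v n \<Longrightarrow> v = 0\<^sub>v n"
  shows "invertible_mat A"
proof -
  have "det A \<noteq> 0"
    using det_0_iff_vec_prod_zero[OF A] ker by auto
  from det_non_zero_imp_unit[OF A this, of "()"] obtain B
    where "B \<in> carrier_mat n n" "A * B = 1\<^sub>m n" "B * A = 1\<^sub>m n"
    by (auto simp: Units_def ring_mat_def)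
  with A show ?thesis
    unfolding invertible_mat_def inverts_mat_def by (intro conjI exI[of _ B]) auto
qed

lemma norm2_nonneg [simp]: "norm2 v \<ge> 0"
  by (simp add: norm2_def sum_nonneg)

lemma norm2_power2: "(norm2 v)\<^sup>2 = (\<Sum>i<dim_vec v. (norm (v $ i))\<^sup>2)"
  by (simp add: norm2_def sum_nonneg)

lemma norm2_power2_real: "(norm2 (v :: real vec))\<^sup>2 = v \<bullet> v"
  unfolding norm2_power2 by (simp add: scalar_prod_def power2_eq_square atLeast0LessThan)

lemma norm2_eq_0_iff: "norm2 v = 0 \<longleftrightarrow> v = 0\<^sub>v (dim_vec v)"
proof -
  have "norm2 v = 0 \<longleftrightarrow> (\<forall>i<dim_vec v. v $ i = 0)"
    by (auto simp: norm2_def sum_nonneg_eq_0_iff)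
  also have "\<dots> \<longleftrightarrow> v = 0\<^sub>v (dim_vec v)"
    by (metis eq_vecI index_zero_vec)
  finally show ?thesis .
qed

context
  fixes M :: "real mat" and k l :: nat
  assumes M: "M \<in> carrier_mat k l"
    and surj: "\<And>b. b \<in> carrier_vec k \<Longrightarrow> \<exists>x\<in>carrier_vec l. M *\<^sub>v x = b"
begin

lemma scalar_prod_transpose:
  assumes "x \<in> carrier_vec l" "w \<in> carrier_vec k"
  shows "x \<bullet> (transpose_mat M *\<^sub>v w) = (M *\<^sub>v x) \<bullet> w"
  using transpose_vec_mult_scalar[OF M assms] assms M
  by (metis comm_scalar_prod mult_mat_vec_carrier transpose_carrier_mat)

text \<open>If the Gram matrix kills \<open>v\<close>, then
  \<open>transpose_mat M *\<^sub>v v\<close> has norm zero. By surjectivity \<open>v\<close> is some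
  \<open>M *\<^sub>v x\<close>, so \<open>v \<bullet> v\<close> is the product of \<open>x\<close>
  with that zero vector.\<close>

lemma invertible_gram: "invertible_mat (M * transpose_mat M)"
proof (rule invertible_mat_if_kernel_trivial)
  show "M * transpose_mat M \<in> carrier_mat k k" using M by simp
  fix v assume v: "v \<in> carrier_vec k" and 0: "(M * transpose_mat M) *\<^sub>v v = 0\<^sub>v k"
  let ?y = "transpose_mat M *\<^sub>v v"
  have y: "?y \<in> carrier_vec l" using M v by simp
  have "M *\<^sub>v ?y = 0\<^sub>v k" using 0 M v by simp
  hence "?y \<bullet> ?y = 0" using scalar_prod_transpose[OF y v] v by simp
  hence "norm2 ?y = 0" using norm2_power2_real[of ?y] by simp
  hence y0: "?y = 0\<^sub>v l" using carrier_vecD[OF y] by (simp only: norm2_eq_0_iff)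
  obtain x where x: "x \<in> carrier_vec l" "M *\<^sub>v x = v" using surj[OF v] by blast
  hence "v \<bullet> v = 0" using scalar_prod_transpose[OF x(1) v] y0 by simp
  hence "norm2 v = 0" using norm2_power2_real[of v] by simp
  thus "v = 0\<^sub>v k" using carrier_vecD[OF v] by (simp only: norm2_eq_0_iff)
qed

text \<open>The vector \<open>x0\<close> lies in the row space of \<open>M\<close>, hence is
  orthogonal to the kernel, which contains \<open>x - x0\<close> for every other solution
  \<open>x\<close>. Pythagoras gives minimality.\<close>

lemma least_norm_solution:
  assumes b: "b \<in> carrier_vec k"
  defines "x0 \<equiv> transpose_mat M * inv_mat (M * transpose_mat M) *\<^sub>v b"
  shows "x0 \<in> carrier_vec l" "M *\<^sub>v x0 = b"
    and "\<And>x. x \<in> carrier_vec l \<Longrightarrow> M *\<^sub>v x = b \<Longrightarrow> norm2 x0 \<le> norm2 x"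
proof -
  let ?H = "M * transpose_mat M"
  have H: "?H \<in> carrier_mat k k" using M by simp
  note inv = inv_mat[OF H invertible_gram]
  define w where "w = inv_mat ?H *\<^sub>v b"
  have w: "w \<in> carrier_vec k" using inv b by (simp add: w_def)
  have x0_w: "x0 = transpose_mat M *\<^sub>v w"
    using M b inv by (simp add: x0_def w_def assoc_mult_mat_vec[of _ l k])
  show x0: "x0 \<in> carrier_vec l" using M w by (simp add: x0_w)
  have "M *\<^sub>v x0 = ?H *\<^sub>v w" using M w by (simp add: x0_w)
  also have "\<dots> = (?H * inv_mat ?H) *\<^sub>v b"
    unfolding w_def using H inv(1) b by (simp only: assoc_mult_mat_vec)
  finally show Mx0: "M *\<^sub>v x0 = b" using inv b by simp
  fix x assume x: "x \<in> carrier_vec l" and Mx: "M *\<^sub>v x = b"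
  \<comment> \<open>Both products equal \<open>b \<bullet> w\<close>, because moving
    \<open>transpose_mat M\<close> across turns either solution into \<open>b\<close>.\<close>
  have cross: "x \<bullet> x0 = x0 \<bullet> x0"
    using scalar_prod_transpose[OF x w] scalar_prod_transpose[OF x0 w] Mx Mx0 by (simp add: x0_w)
  have "(x - x0) \<bullet> (x - x0) = x \<bullet> x - x0 \<bullet> x0"
    using x x0 cross
    by (simp add: minus_scalar_prod_distrib[of _ l] scalar_prod_minus_distrib[of _ l]
        comm_scalar_prod[of x0 l x])
  hence "(norm2 x)\<^sup>2 = (norm2 x0)\<^sup>2 + (norm2 (x - x0))\<^sup>2"
    by (simp add: norm2_power2_real)
  hence "(norm2 x0)\<^sup>2 \<le> (norm2 x)\<^sup>2" by simp
  thus "norm2 x0 \<le> norm2 x" by (rule power2_le_imp_le) simp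
qed

end

section \<open>Vectorization and sparsity patterns\<close>

text \<open>In column-major order the positions with quotient \<open>j\<close> by \<open>r\<close>
  form one block of length \<open>r\<close>, so a sum over the stacked vector regroups into
  columns.\<close>

lemma sum_mod_div:
  fixes h :: "nat \<Rightarrow> nat \<Rightarrow> 'a::comm_monoid_add"
  shows "(\<Sum>x<r * c. h (x mod r) (x div r)) = (\<Sum>j<c. \<Sum>i<r. h i j)"
proof -
  have block: "(\<Sum>x\<in>{j * r..<j * r + r}. h (x mod r) (x div r)) = (\<Sum>i<r. h i j)" for j
  proof -
    have "(\<Sum>x\<in>{j * r..<j * r + r}. h (x mod r) (x div r))
        = (\<Sum>i\<in>{0..<r}. h ((i + j * r) mod r) ((i + j * r) div r))"
      using sum.shift_bounds_nat_ivl[of "\<lambda>x. h (x mod r) (x div r)" 0 "j * r" r] by (simp add: add.commute)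
    thus ?thesis by (simp add: atLeast0LessThan)
  qed
  have "(\<Sum>x<r * c. h (x mod r) (x div r)) = (\<Sum>j<c. \<Sum>x\<in>{j * r..<j * r + r}. h (x mod r) (x div r))"
    using sum.nat_group[of "\<lambda>x. h (x mod r) (x div r)" r c] by (simp add: mult.commute)
  thus ?thesis by (simp only: block)
qed

lemma vec_stack_index:
  "x < dim_row A * dim_col A \<Longrightarrow> vec_stack A $ x = A $$ (x mod dim_row A, x div dim_row A)"
  by (simp add: vec_stack_def)

lemma vec_stack_dim [simp]: "dim_vec (vec_stack A) = dim_row A * dim_col A"
  by (simp add: vec_stack_def)

lemma vec_stack_carrier [simp]: "A \<in> carrier_mat r c \<Longrightarrow> vec_stack A \<in> carrier_vec (r * c)"
  by (intro carrier_vecI) auto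

lemma mod_div_less:
  assumes "x < r * c" shows "x mod r < r" "x div r < (c::nat)"
proof -
  have "r \<noteq> 0" using assms by (cases r) auto
  thus "x mod r < r" "x div r < c"
    using assms by (simp_all add: less_mult_imp_div_less mult.commute)
qed

lemma ex_vec_stack:
  assumes "v \<in> carrier_vec (r * c)"
  obtains A where "A \<in> carrier_mat r c" "vec_stack A = v"
proof
  let ?A = "mat r c (\<lambda>(i, j). v $ (i + j * r))"
  show "?A \<in> carrier_mat r c" by simp
  show "vec_stack ?A = v"
    using assms by (intro eq_vecI) (auto simp: vec_stack_index mod_div_less)
qed

lemma frob_norm_nonneg [simp]: "frob_norm A \<ge> 0"
  by (simp add: frob_norm_def sum_nonneg)

lemma frob_norm_power2:
  "(frob_norm A)\<^sup>2 = (\<Sum>i<dim_row A. \<Sum>j<dim_col A. (norm (A $$ (i, j)))\<^sup>2)"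
  by (simp add: frob_norm_def sum_nonneg)

lemma norm2_vec_stack: "norm2 (vec_stack A) = frob_norm A"
proof -
  have "(\<Sum>x<dim_row A * dim_col A. (norm (vec_stack A $ x))\<^sup>2)
      = (\<Sum>j<dim_col A. \<Sum>i<dim_row A. (norm (A $$ (i, j)))\<^sup>2)"
    using sum_mod_div[of "\<lambda>i j. (norm (A $$ (i, j)))\<^sup>2" "dim_row A" "dim_col A"]
    by (simp add: vec_stack_index)
  thus ?thesis
    unfolding norm2_def frob_norm_def by (simp add: sum.swap[of _ "{..<dim_row A}"])
qed

lemma mat_diag_mult_vec:
  fixes f :: "nat \<Rightarrow> 'a::semiring_0"
  assumes "v \<in> carrier_vec n"
  shows "mat_diag n f *\<^sub>v v = vec n (\<lambda>i. f i * v $ i)"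
proof (rule eq_vecI)
  fix i assume "i < dim_vec (vec n (\<lambda>i. f i * v $ i))"
  hence i: "i < n" by simp
  have "(mat_diag n f *\<^sub>v v) $ i = (\<Sum>j = 0..<n. (if i = j then f j else 0) * v $ j)"
    using i assms by (simp add: mat_diag_def scalar_prod_def)
  also have "\<dots> = (\<Sum>j = 0..<n. if j = i then f j * v $ j else 0)"
    by (rule sum.cong) auto
  finally show "(mat_diag n f *\<^sub>v v) $ i = vec n (\<lambda>i. f i * v $ i) $ i"
    using i by simp
qed (simp add: mat_diag_def)

text \<open>Phrased as cancellation on vectors, which is how the weights \<open>D_S\<close> and
  \<open>D_SK\<close> are undone later; no entry of the inverse has to be computed.\<close>

lemma inv_mat_diag:
  fixes f :: "nat \<Rightarrow> 'a::field"
  assumes nz: "\<And>i. i < n \<Longrightarrow> f i \<noteq> 0" and v: "v \<in> carrier_vec n"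
  shows "inv_mat (mat_diag n f) \<in> carrier_mat n n"
    "mat_diag n f *\<^sub>v (inv_mat (mat_diag n f) *\<^sub>v v) = v"
    "inv_mat (mat_diag n f) *\<^sub>v (mat_diag n f *\<^sub>v v) = v"
proof -
  have one: "mat_diag n (\<lambda>i. f i * inverse (f i)) = 1\<^sub>m n" "mat_diag n (\<lambda>i. inverse (f i) * f i) = 1\<^sub>m n"
    using nz by (intro eq_matI; simp add: mat_diag_def)+
  have "invertible_mat (mat_diag n f)"
    unfolding invertible_mat_def inverts_mat_def
    using one by (auto simp: carrier_matD[OF mat_diag_dim] intro!: exI[of _ "mat_diag n (\<lambda>i. inverse (f i))"])
  note inv = inv_mat[OF mat_diag_dim this]
  show "inv_mat (mat_diag n f) \<in> carrier_mat n n" by fact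
  show "mat_diag n f *\<^sub>v (inv_mat (mat_diag n f) *\<^sub>v v) = v"
    using inv v by (metis assoc_mult_mat_vec mat_diag_dim one_mult_mat_vec)
  show "inv_mat (mat_diag n f) *\<^sub>v (mat_diag n f *\<^sub>v v) = v"
    using inv v by (metis assoc_mult_mat_vec mat_diag_dim one_mult_mat_vec)
qed

section \<open>Masking by a sparsity pattern\<close>

text \<open>The two entry types are independent because real coordinate matrices must obey the
  pattern of complex data. The entrywise form passes directly to real and imaginary parts.\<close>

definition sparse_in :: "'a::zero mat \<Rightarrow> 'b::zero mat \<Rightarrow> bool" where
  "sparse_in X A \<longleftrightarrow> (\<forall>i<dim_row A. \<forall>j<dim_col A. X $$ (i, j) = 0 \<longrightarrow> A $$ (i, j) = 0)"

lemma hadamard_dim [simp]: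
  "dim_row (A \<odot>\<^sub>m B) = dim_row A" "dim_col (A \<odot>\<^sub>m B) = dim_col A"
  by (simp_all add: hadamard_def)

lemma hadamard_carrier [simp]: "A \<odot>\<^sub>m B \<in> carrier_mat r c \<longleftrightarrow> A \<in> carrier_mat r c"
  unfolding carrier_mat_def mem_Collect_eq hadamard_dim ..

lemma hadamard_Theta_index:
  fixes A :: "'a::semiring_1 mat"
  assumes "A \<in> carrier_mat r c" "X \<in> carrier_mat r c" "i < r" "j < c"
  shows "(A \<odot>\<^sub>m Theta X) $$ (i, j) = (if X $$ (i, j) = 0 then 0 else A $$ (i, j))"
  using assms by (simp add: hadamard_def Theta_def carrier_matD[OF assms(1)] carrier_matD[OF assms(2)])

lemma sparse_in_hadamard_Theta:
  fixes A :: "'a::semiring_1 mat"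
  assumes "A \<in> carrier_mat r c" "X \<in> carrier_mat r c"
  shows "sparse_in X (A \<odot>\<^sub>m Theta X)"
  using assms(1) by (simp add: sparse_in_def hadamard_Theta_index[OF assms])

lemma sparse_in_iff_hadamard_Theta:
  fixes A :: "'a::semiring_1 mat"
  assumes A: "A \<in> carrier_mat r c" and X: "X \<in> carrier_mat r c"
  shows "sparse_in X A \<longleftrightarrow> A \<odot>\<^sub>m Theta X = A"
proof
  assume "sparse_in X A"
  thus "A \<odot>\<^sub>m Theta X = A"
    using A by (intro eq_matI) (auto simp: hadamard_Theta_index[OF A X] sparse_in_def)
next
  assume "A \<odot>\<^sub>m Theta X = A"
  thus "sparse_in X A" using sparse_in_hadamard_Theta[OF A X] by simp
qed

lemma frob_norm_hadamard_Theta_le: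
  fixes A :: "'a::real_normed_algebra_1 mat"
  assumes "A \<in> carrier_mat r c" "X \<in> carrier_mat r c"
  shows "frob_norm (A \<odot>\<^sub>m Theta X) \<le> frob_norm A"
  using assms unfolding frob_norm_def
  by (auto simp: hadamard_Theta_index[OF assms] intro!: sum_mono)

text \<open>Coordinates that \<open>S\<close> ignores make a matrix smaller than its coordinate vector, hence the
  inequality in the first half; the second half gives each matrix a vector without such coordinates.\<close>
definition isometric_param :: "real mat \<Rightarrow> real mat set \<Rightarrow> bool" where
  "isometric_param S C \<longleftrightarrow>
     (\<forall>s\<in>carrier_vec (dim_col S). \<exists>Z\<in>C. S *\<^sub>v s = vec_stack Z \<and> frob_norm Z \<le> norm2 s) \<and>
     (\<forall>Z\<in>C. \<exists>s\<in>carrier_vec (dim_col S). S *\<^sub>v s = vec_stack Z \<and> norm2 s = frob_norm Z)"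

lemma Sigma_mat_carrier:
  "X \<in> carrier_mat r c \<Longrightarrow> Sigma_mat X \<in> carrier_mat (r * c) (r * c)"
  by (auto simp: Sigma_mat_def diag_of_vec_def mat_diag_def Theta_def)

lemma Sigma_mat_mult_vec_stack:
  assumes A: "A \<in> carrier_mat r c" and X: "X \<in> carrier_mat r c"
  shows "Sigma_mat X *\<^sub>v vec_stack A = vec_stack (A \<odot>\<^sub>m Theta X)"
proof -
  have d: "dim_vec (vec_stack (Theta X)) = r * c" using X by (simp add: Theta_def)
  have "Sigma_mat X *\<^sub>v vec_stack A = vec (r * c) (\<lambda>x. vec_stack (Theta X) $ x * vec_stack A $ x)"
    unfolding Sigma_mat_def diag_of_vec_def d using A by (intro mat_diag_mult_vec) simp
  also have "\<dots> = vec_stack (A \<odot>\<^sub>m Theta X)"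
    using A X by (intro eq_vecI)
      (auto simp: vec_stack_index mod_div_less hadamard_Theta_index, auto simp: vec_stack_def Theta_def mod_div_less)
  finally show ?thesis .
qed

text \<open>In stacked coordinates \<open>Sigma_mat X\<close> is masking: an arbitrary vector is the
  stack of some matrix and is sent to the stack of its mask, while a matrix that obeys the pattern
  is fixed.\<close>

lemma isometric_param_Sigma_mat:
  assumes X: "X \<in> carrier_mat r c"
  shows "isometric_param (Sigma_mat X) {A. A \<in> carrier_mat r c \<and> sparse_in X A}" (is "isometric_param _ ?C")
  unfolding isometric_param_def
proof (intro conjI ballI)
  have dim: "dim_col (Sigma_mat X) = r * c" using Sigma_mat_carrier[OF X] by auto
  fix s :: "real vec" assume "s \<in> carrier_vec (dim_col (Sigma_mat X))"
  then obtain A where A: "A \<in> carrier_mat r c" "vec_stack A = s"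
    unfolding dim by (rule ex_vec_stack)
  show "\<exists>Z\<in>?C. Sigma_mat X *\<^sub>v s = vec_stack Z \<and> frob_norm Z \<le> norm2 s"
    using Sigma_mat_mult_vec_stack[OF A(1) X] A frob_norm_hadamard_Theta_le[OF A(1) X]
      sparse_in_hadamard_Theta[OF A(1) X]
    by (intro bexI[of _ "A \<odot>\<^sub>m Theta X"]) (auto simp flip: norm2_vec_stack)
next
  have dim: "dim_col (Sigma_mat X) = r * c" using Sigma_mat_carrier[OF X] by auto
  fix A assume "A \<in> ?C"
  thus "\<exists>s\<in>carrier_vec (dim_col (Sigma_mat X)). Sigma_mat X *\<^sub>v s = vec_stack A \<and> norm2 s = frob_norm A"
    using Sigma_mat_mult_vec_stack[OF _ X, of A] X
    by (intro bexI[of _ "vec_stack A"]) (auto simp: norm2_vec_stack dim sparse_in_iff_hadamard_Theta)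
qed

section \<open>Half-vectorizations\<close>

text \<open>Induction peels off the last row and the last column, which agree by symmetry. The
  factor 2 is what the squared weight \<open>sqrt 2\<close> has to reproduce.\<close>

lemma sum_triangle:
  fixes h :: "nat \<Rightarrow> nat \<Rightarrow> 'a::comm_semiring_1"
  assumes sym: "\<And>i j. i < k \<Longrightarrow> j < k \<Longrightarrow> h i j = h j i"
  shows "(\<Sum>i<k. \<Sum>j<k. h i j) = (\<Sum>i<k. h i i) + 2 * (\<Sum>i<k. \<Sum>j<i. h i j)"
  using sym
proof (induction k)
  case (Suc k)
  have "(\<Sum>i<k. h i k) = (\<Sum>j<k. h k j)" using Suc.prems by (intro sum.cong) auto
  moreover have "(\<Sum>i<k. \<Sum>j<k. h i j) = (\<Sum>i<k. h i i) + 2 * (\<Sum>i<k. \<Sum>j<i. h i j)"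
    using Suc by simp
  ultimately show ?case by (simp add: sum.distrib algebra_simps mult_2)
qed simp

lemma sum_nth_distinct:
  "distinct ps \<Longrightarrow> (\<Sum>c<length ps. g (ps ! c)) = (\<Sum>x\<in>set ps. g x)"
  using sum.reindex_bij_betw[OF bij_betw_nth[OF _ refl refl], of ps g] by simp

lemma lower_pairs_Sigma: "set (lower_pairs k) = (SIGMA i:{..<k}. {..<Suc i})"
  by (auto simp: set_lower_pairs)

lemma strict_lower_pairs_Sigma: "set (strict_lower_pairs k) = (SIGMA i:{..<k}. {..<i})"
  by (auto simp: set_strict_lower_pairs)

text \<open>The list runs through the triangle by columns; a sum does not see the order, so it is
  regrouped by rows to match \<open>sum_triangle\<close>.\<close>

lemma sum_lower_pairs:
  fixes g :: "nat \<times> nat \<Rightarrow> 'a::comm_monoid_add"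
  shows "(\<Sum>c<length (lower_pairs k). g (lower_pairs k ! c)) = (\<Sum>i<k. g (i, i) + (\<Sum>j<i. g (i, j)))"
  unfolding sum_nth_distinct[OF distinct_lower_pairs] lower_pairs_Sigma
  using sum.Sigma[of "{..<k}" "\<lambda>i. {..<Suc i}" "\<lambda>i j. g (i, j)"] by (simp add: add.commute)

lemma sum_strict_lower_pairs:
  fixes g :: "nat \<times> nat \<Rightarrow> 'a::comm_monoid_add"
  shows "(\<Sum>c<length (strict_lower_pairs k). g (strict_lower_pairs k ! c)) = (\<Sum>i<k. \<Sum>j<i. g (i, j))"
  unfolding sum_nth_distinct[OF distinct_strict_lower_pairs] strict_lower_pairs_Sigma
  using sum.Sigma[of "{..<k}" lessThan "\<lambda>i j. g (i, j)"] by simp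

lemma lower_pairs_nth_bounds:
  "c < length (lower_pairs k) \<Longrightarrow> lower_pairs k ! c = (i, j) \<Longrightarrow> i < k \<and> j < k \<and> j \<le> i"
  using nth_mem[of c "lower_pairs k"] by (auto simp: set_lower_pairs)

lemma strict_lower_pairs_nth_bounds:
  "c < length (strict_lower_pairs k) \<Longrightarrow> strict_lower_pairs k ! c = (i, j) \<Longrightarrow> i < k \<and> j < k \<and> j < i"
  using nth_mem[of c "strict_lower_pairs k"] by (auto simp: set_strict_lower_pairs)

lemma vec_S_dim [simp]: "dim_vec (vec_S Z) = length (lower_pairs (dim_row Z))"
  by (simp add: vec_S_def)

lemma vec_SK_dim [simp]: "dim_vec (vec_SK Z) = length (strict_lower_pairs (dim_row Z))"
  by (simp add: vec_SK_def)

lemma vec_S_index: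
  "c < length (lower_pairs (dim_row Z)) \<Longrightarrow> vec_S Z $ c = Z $$ (lower_pairs (dim_row Z) ! c)"
  by (simp add: vec_S_def vec_of_list_index)

lemma vec_SK_index:
  "c < length (strict_lower_pairs (dim_row Z)) \<Longrightarrow> vec_SK Z $ c = Z $$ (strict_lower_pairs (dim_row Z) ! c)"
  by (simp add: vec_SK_def vec_of_list_index)

text \<open>Turns prescribed coordinates into entries at index pairs; by distinctness no pair
  receives two values.\<close>

lemma ex_fun_nth:
  assumes "distinct ps"
  obtains f where "\<And>c. c < length ps \<Longrightarrow> f (ps ! c) = h c"
proof
  fix c assume "c < length ps"
  thus "(h \<circ> inv_into {..<length ps} ((!) ps)) (ps ! c) = h c"
    using inv_into_f_f[OF inj_on_nth[OF assms], of "{..<length ps}" c] by simp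
qed

definition symmetric_mat :: "'a mat \<Rightarrow> bool" where
  "symmetric_mat A \<longleftrightarrow> transpose_mat A = A"

definition skew_mat :: "'a::uminus mat \<Rightarrow> bool" where
  "skew_mat A \<longleftrightarrow> transpose_mat A = - A"

lemma symmetric_mat_iff:
  assumes "A \<in> carrier_mat k k"
  shows "symmetric_mat A \<longleftrightarrow> (\<forall>i<k. \<forall>j<k. A $$ (j, i) = A $$ (i, j))"
  using assms by (auto simp: symmetric_mat_def mat_eq_iff)

lemma skew_mat_iff:
  assumes "A \<in> carrier_mat k k"
  shows "skew_mat A \<longleftrightarrow> (\<forall>i<k. \<forall>j<k. A $$ (j, i) = - A $$ (i, j))"
  using assms by (auto simp: skew_mat_def mat_eq_iff)

lemma ex_vec_S:
  fixes v :: "'a vec"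
  assumes v: "v \<in> carrier_vec (length (lower_pairs k))"
  obtains Z where "Z \<in> carrier_mat k k" "symmetric_mat Z" "vec_S Z = v"
proof -
  obtain f where f: "\<And>c. c < length (lower_pairs k) \<Longrightarrow> f (lower_pairs k ! c) = v $ c"
    using ex_fun_nth[OF distinct_lower_pairs] by blast
  \<comment> \<open>\<open>(max i j, min i j)\<close> is the lower-triangle representative of
    \<open>(i, j)\<close> and \<open>(j, i)\<close>; \<open>f\<close> is controlled only
    there.\<close>
  define Z where "Z = mat k k (\<lambda>(i, j). f (max i j, min i j))"
  have Z: "Z \<in> carrier_mat k k" by (simp add: Z_def)
  moreover have "symmetric_mat Z"
    unfolding symmetric_mat_iff[OF Z] by (simp add: Z_def max.commute min.commute)
  moreover have "vec_S Z = v"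
  proof (rule eq_vecI)
    fix c assume "c < dim_vec v"
    hence c: "c < length (lower_pairs k)" using v by simp
    obtain i j where ij: "lower_pairs k ! c = (i, j)" by fastforce
    hence "Z $$ (i, j) = f (i, j)" using lower_pairs_nth_bounds[OF c ij] by (simp add: Z_def)
    thus "vec_S Z $ c = v $ c" using f[OF c] c ij Z by (simp add: vec_S_index)
  qed (use v Z in simp)
  ultimately show thesis by (rule that)
qed

lemma ex_vec_SK:
  fixes v :: "'a::ring_1 vec"
  assumes v: "v \<in> carrier_vec (length (strict_lower_pairs k))"
  obtains Z where "Z \<in> carrier_mat k k" "skew_mat Z" "vec_SK Z = v"
proof -
  obtain f where f: "\<And>c. c < length (strict_lower_pairs k) \<Longrightarrow> f (strict_lower_pairs k ! c) = v $ c"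
    using ex_fun_nth[OF distinct_strict_lower_pairs] by blast
  define Z where "Z = mat k k (\<lambda>(i, j). if j < i then f (i, j) else if i < j then - f (j, i) else 0)"
  have Z: "Z \<in> carrier_mat k k" by (simp add: Z_def)
  moreover have "skew_mat Z"
    unfolding skew_mat_iff[OF Z] by (simp add: Z_def)
  moreover have "vec_SK Z = v"
  proof (rule eq_vecI)
    fix c assume "c < dim_vec v"
    hence c: "c < length (strict_lower_pairs k)" using v by simp
    obtain i j where ij: "strict_lower_pairs k ! c = (i, j)" by fastforce
    hence "Z $$ (i, j) = f (i, j)" using strict_lower_pairs_nth_bounds[OF c ij] by (simp add: Z_def)
    thus "vec_SK Z $ c = v $ c" using f[OF c] c ij Z by (simp add: vec_SK_index)
  qed (use v Z in simp)
  ultimately show thesis by (rule that)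
qed

text \<open>Column \<open>j\<close> of the lower triangle has \<open>k - j\<close> entries, so the
  columns before column \<open>i\<close> hold \<open>d\<close> entries in all, and the diagonal
  entry opens column \<open>i\<close>.\<close>

lemma lower_pairs_nth_diagonal:
  assumes "i < k"
  defines "d \<equiv> (2 * k + 1 - i) * i div 2"
  shows "d < length (lower_pairs k)" "lower_pairs k ! d = (i, i)"
proof -
  let ?col = "\<lambda>j. map (\<lambda>i. (i, j)) [j..<k]"
  \<comment> \<open>The count is doubled so that the induction does not meet
    \<open>div\<close>.\<close>
  have "2 * length (concat (map ?col [0..<i])) = (2 * k + 1 - i) * i" if "i \<le> k" for i
    using that
  proof (induction i)
    case (Suc i)
    \<comment> \<open>Writing \<open>k\<close> as a sum removes the truncated subtraction in
      \<open>2 * k + 1 - i\<close>.\<close>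
    then obtain e where "k = Suc i + e" by (auto dest: le_Suc_ex)
    thus ?case using Suc by (simp add: algebra_simps)
  qed simp
  from this[of i] assms have len: "length (concat (map ?col [0..<i])) = d" by simp
  have "[0..<k] = [0..<i] @ i # [Suc i..<k]"
    using assms by (metis less_imp_le upt_add_eq_append upt_conv_Cons zero_le le_add_diff_inverse)
  hence "lower_pairs k = concat (map ?col [0..<i]) @ ?col i @ concat (map ?col [Suc i..<k])"
    by (simp add: lower_pairs_def)
  moreover have "?col i = (i, i) # map (\<lambda>i'. (i', i)) [Suc i..<k]"
    using assms by (simp add: upt_conv_Cons)
  ultimately obtain ys where ys: "lower_pairs k = concat (map ?col [0..<i]) @ (i, i) # ys" by simp
  show "d < length (lower_pairs k)" "lower_pairs k ! d = (i, i)"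
    using len unfolding ys by (auto simp: nth_append)
qed

text \<open>The closed formula for positions is replaced by a test on the index pair: each formula
  value is the place of some \<open>(i, i)\<close>, and by distinctness of the list
  \<open>(i, i)\<close> stands nowhere else.\<close>

lemma D_S_eq:
  "D_S k = mat_diag (length (lower_pairs k))
     (\<lambda>c. if fst (lower_pairs k ! c) = snd (lower_pairs k ! c) then 1 else sqrt 2)"
proof -
  have "(\<exists>i<k. c = (2 * k + 1 - i) * i div 2) \<longleftrightarrow> fst (lower_pairs k ! c) = snd (lower_pairs k ! c)"
    if c: "c < length (lower_pairs k)" for c
  proof
    assume "\<exists>i<k. c = (2 * k + 1 - i) * i div 2"
    thus "fst (lower_pairs k ! c) = snd (lower_pairs k ! c)"
      using lower_pairs_nth_diagonal(2) by fastforce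
  next
    assume "fst (lower_pairs k ! c) = snd (lower_pairs k ! c)"
    then obtain i where i: "lower_pairs k ! c = (i, i)" by (metis prod.collapse)
    hence "i < k" using lower_pairs_nth_bounds[OF c i] by simp
    from lower_pairs_nth_diagonal[OF this] i c
    have "c = (2 * k + 1 - i) * i div 2"
      using nth_eq_iff_index_eq[OF distinct_lower_pairs] by metis
    with \<open>i < k\<close> show "\<exists>i<k. c = (2 * k + 1 - i) * i div 2" by blast
  qed
  thus ?thesis
    unfolding D_S_def length_lower_pairs[symmetric]
    by (intro eq_matI) (simp_all add: mat_diag_def)
qed

lemma norm2_D_S_vec_S:
  assumes Z: "Z \<in> carrier_mat k k" and sym: "symmetric_mat Z"
  shows "norm2 (D_S k *\<^sub>v vec_S Z) = frob_norm Z"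
proof -
  let ?ps = "lower_pairs k"
  let ?w = "\<lambda>x :: nat \<times> nat. if fst x = snd x then 1 else sqrt 2 :: real"
  have "vec_S Z \<in> carrier_vec (length ?ps)" using Z by (intro carrier_vecI) simp
  hence "D_S k *\<^sub>v vec_S Z = vec (length ?ps) (\<lambda>c. ?w (?ps ! c) * vec_S Z $ c)"
    unfolding D_S_eq by (rule mat_diag_mult_vec)
  hence "(norm2 (D_S k *\<^sub>v vec_S Z))\<^sup>2 = (\<Sum>c<length ?ps. (norm (?w (?ps ! c) * vec_S Z $ c))\<^sup>2)"
    by (simp add: norm2_power2)
  also have "\<dots> = (\<Sum>c<length ?ps. (norm (?w (?ps ! c) * Z $$ (?ps ! c)))\<^sup>2)"
    using Z by (intro sum.cong) (auto simp: vec_S_index)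
  also have "\<dots> = (\<Sum>i<k. (Z $$ (i, i))\<^sup>2 + (\<Sum>j<i. 2 * (Z $$ (i, j))\<^sup>2))"
    unfolding sum_lower_pairs[of "\<lambda>x. (norm (?w x * Z $$ x))\<^sup>2"]
    by (intro sum.cong arg_cong2[of _ _ _ _ "(+)"]) (auto simp: power_mult_distrib)
  also have "\<dots> = (\<Sum>i<k. \<Sum>j<k. (Z $$ (i, j))\<^sup>2)"
    using sym[unfolded symmetric_mat_iff[OF Z]]
    by (subst sum_triangle) (auto simp: sum.distrib sum_distrib_left)
  also have "\<dots> = (frob_norm Z)\<^sup>2" using Z by (simp add: frob_norm_power2)
  finally show ?thesis by simp
qed

lemma D_SK_eq: "D_SK k = mat_diag (length (strict_lower_pairs k)) (\<lambda>_. sqrt 2)"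
  unfolding D_SK_def length_strict_lower_pairs by (intro eq_matI) (auto simp: mat_diag_def)

lemma norm2_D_SK_vec_SK:
  assumes Z: "Z \<in> carrier_mat k k" and skew: "skew_mat Z"
  shows "norm2 (D_SK k *\<^sub>v vec_SK Z) = frob_norm Z"
proof -
  let ?ps = "strict_lower_pairs k"
  have "vec_SK Z \<in> carrier_vec (length ?ps)" using Z by (intro carrier_vecI) simp
  hence "D_SK k *\<^sub>v vec_SK Z = vec (length ?ps) (\<lambda>c. sqrt 2 * vec_SK Z $ c)"
    unfolding D_SK_eq by (rule mat_diag_mult_vec)
  hence "(norm2 (D_SK k *\<^sub>v vec_SK Z))\<^sup>2 = (\<Sum>c<length ?ps. (norm (sqrt 2 * vec_SK Z $ c))\<^sup>2)"
    by (simp add: norm2_power2)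
  also have "\<dots> = (\<Sum>c<length ?ps. (norm (sqrt 2 * Z $$ (?ps ! c)))\<^sup>2)"
    using Z by (intro sum.cong) (auto simp: vec_SK_index)
  also have "\<dots> = (\<Sum>i<k. \<Sum>j<i. 2 * (Z $$ (i, j))\<^sup>2)"
    unfolding sum_strict_lower_pairs[of "\<lambda>x. (norm (sqrt 2 * Z $$ x))\<^sup>2"]
    by (intro sum.cong) (auto simp: power_mult_distrib)
  also have "\<dots> = (\<Sum>i<k. \<Sum>j<k. (Z $$ (i, j))\<^sup>2)"
  proof -
    \<comment> \<open>Skewness annihilates the diagonal and disappears under squaring, so the count
      for symmetric arrays applies to the squared entries with no diagonal term.\<close>
    have sk: "Z $$ (j, i) = - Z $$ (i, j)" if "i < k" "j < k" for i j
      using skew[unfolded skew_mat_iff[OF Z]] that by blast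
    have "(Z $$ (i, i))\<^sup>2 = 0" if "i < k" for i
      using sk[OF that that] by simp
    moreover have "(Z $$ (i, j))\<^sup>2 = (Z $$ (j, i))\<^sup>2" if "i < k" "j < k" for i j
      using sk[OF that] by simp
    ultimately show ?thesis
      using sum_triangle[of k "\<lambda>i j. (Z $$ (i, j))\<^sup>2"] by (simp add: sum_distrib_left)
  qed
  also have "\<dots> = (frob_norm Z)\<^sup>2" using Z by (simp add: frob_norm_power2)
  finally show ?thesis by simp
qed

section \<open>Hermitian patterns and masked half-vectorizations\<close>

lemma mat_adjoint_dim [simp]:
  "dim_row (mat_adjoint A) = dim_col A" "dim_col (mat_adjoint A) = dim_row A"
  by (simp_all add: mat_adjoint_def)

lemma mat_adjoint_index [simp]:
  "i < dim_col A \<Longrightarrow> j < dim_row A \<Longrightarrow> mat_adjoint A $$ (i, j) = conjugate (A $$ (j, i))"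
  by (simp add: mat_adjoint_def mat_of_rows_index)

lemma hermitian_mat_iff:
  assumes A: "A \<in> carrier_mat k k"
  shows "hermitian_mat A \<longleftrightarrow> (\<forall>i<k. \<forall>j<k. A $$ (j, i) = cnj (A $$ (i, j)))"
proof -
  have "hermitian_mat A \<longleftrightarrow> (\<forall>i<k. \<forall>j<k. mat_adjoint A $$ (j, i) = A $$ (j, i))"
    unfolding hermitian_mat_def mat_eq_iff mat_adjoint_dim carrier_matD[OF A] by blast
  also have "\<dots> \<longleftrightarrow> (\<forall>i<k. \<forall>j<k. A $$ (j, i) = cnj (A $$ (i, j)))"
    using carrier_matD[OF A] by (simp add: eq_commute[of "cnj _"])
  finally show ?thesis .
qed

text \<open>Conjugation preserves zeros, so a Hermitian matrix has a symmetric pattern even though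
  its entries are not symmetric.\<close>

lemma hermitian_pattern:
  assumes "hermitian_mat A" "A \<in> carrier_mat k k" "i < k" "j < k"
  shows "A $$ (j, i) = 0 \<longleftrightarrow> A $$ (i, j) = 0"
proof -
  have "A $$ (j, i) = cnj (A $$ (i, j))"
    using assms hermitian_mat_iff by blast
  thus ?thesis by simp
qed

lemma Phi_mat_mult_vec_S:
  assumes Z: "Z \<in> carrier_mat k k" and G: "G \<in> carrier_mat k k"
  shows "Phi_mat G *\<^sub>v vec_S Z = vec_S (Z \<odot>\<^sub>m Theta G)"
proof -
  let ?N = "length (lower_pairs k)"
  have d: "dim_vec (vec_S (Theta G :: real mat)) = ?N" using G by (simp add: Theta_def)
  have v: "vec_S Z \<in> carrier_vec ?N" using Z by (intro carrier_vecI) simp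
  have "Phi_mat G *\<^sub>v vec_S Z = vec ?N (\<lambda>c. vec_S (Theta G) $ c * vec_S Z $ c)"
    unfolding Phi_mat_def diag_of_vec_def d using v by (rule mat_diag_mult_vec)
  also have "\<dots> = vec_S (Z \<odot>\<^sub>m Theta G)"
  proof (rule eq_vecI)
    fix c assume "c < dim_vec (vec_S (Z \<odot>\<^sub>m Theta G))"
    hence c: "c < ?N" using Z by simp
    obtain i j where ij: "lower_pairs k ! c = (i, j)" by fastforce
    from lower_pairs_nth_bounds[OF c ij]
    show "vec ?N (\<lambda>c. vec_S (Theta G) $ c * vec_S Z $ c) $ c = vec_S (Z \<odot>\<^sub>m Theta G) $ c"
      using c ij Z G by (simp add: vec_S_index hadamard_def Theta_def)
  qed (use Z in simp)
  finally show ?thesis .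
qed

text \<open>Running through the upper triangle by rows visits the transposed positions of the lower
  triangle by columns in the same order; this aligns the diagonal of \<open>Psi_mat\<close> with the
  coordinates of \<open>vec_SK\<close>.\<close>

lemma strict_upper_pairs_eq: "strict_upper_pairs k = map prod.swap (strict_lower_pairs k)"
  by (simp add: strict_upper_pairs_def strict_lower_pairs_def map_concat o_def)

text \<open>The coordinate at \<open>(i, j)\<close> is multiplied by the pattern of \<open>G\<close>
  at \<open>(j, i)\<close>; the two pattern entries agree because \<open>G\<close> is
  Hermitian.\<close>

lemma Psi_mat_mult_vec_SK:
  assumes Z: "Z \<in> carrier_mat k k" and G: "G \<in> carrier_mat k k" and herm: "hermitian_mat G"
  shows "Psi_mat G *\<^sub>v vec_SK Z = vec_SK (Z \<odot>\<^sub>m Theta G)"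
proof -
  let ?N = "length (strict_lower_pairs k)"
  let ?t = "vec_of_list (map (\<lambda>ij. Theta G $$ ij) (strict_upper_pairs k)) :: real vec"
  have d: "dim_vec ?t = ?N" by (simp add: strict_upper_pairs_eq)
  have v: "vec_SK Z \<in> carrier_vec ?N" using Z by (intro carrier_vecI) simp
  have "Psi_mat G *\<^sub>v vec_SK Z = vec ?N (\<lambda>c. ?t $ c * vec_SK Z $ c)"
    unfolding Psi_mat_def diag_of_vec_def carrier_matD(1)[OF G] d using v by (rule mat_diag_mult_vec)
  also have "\<dots> = vec_SK (Z \<odot>\<^sub>m Theta G)"
  proof (rule eq_vecI)
    fix c assume "c < dim_vec (vec_SK (Z \<odot>\<^sub>m Theta G))"
    hence c: "c < ?N" using Z by simp
    obtain i j where ij: "strict_lower_pairs k ! c = (i, j)" by fastforce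
    note bounds = strict_lower_pairs_nth_bounds[OF c ij]
    hence "G $$ (j, i) = 0 \<longleftrightarrow> G $$ (i, j) = 0"
      using hermitian_pattern[OF herm G] by blast
    thus "vec ?N (\<lambda>c. ?t $ c * vec_SK Z $ c) $ c = vec_SK (Z \<odot>\<^sub>m Theta G) $ c"
      using c ij Z G bounds
      by (simp add: vec_SK_index hadamard_def Theta_def vec_of_list_index strict_upper_pairs_eq)
  qed (use Z in simp)
  finally show ?thesis .
qed

text \<open>The common core of the symmetric and the skew case. With \<open>T\<close> the symmetry
  class, \<open>s = mat_diag N f *\<^sub>v half Z\<close> is a norm-preserving coordinate vector for
  \<open>Z\<close>; in \<open>S\<close> the inverse removes the weights, \<open>P\<close> masks, and
  \<open>J\<close> expands the half-vector to the full stack. Closure of \<open>T\<close> under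
  masking keeps the result in the class.\<close>

lemma isometric_param_half_vectorization:
  fixes J P :: "real mat" and f :: "nat \<Rightarrow> real" and half :: "real mat \<Rightarrow> real vec"
  assumes J: "J \<in> carrier_mat (m * m) N" and P: "P \<in> carrier_mat N N" and G: "G \<in> carrier_mat m m"
    and f: "\<And>c. c < N \<Longrightarrow> f c \<noteq> 0"
    and half: "\<And>Z. Z \<in> carrier_mat m m \<Longrightarrow> half Z \<in> carrier_vec N"
    and surj: "\<And>v. v \<in> carrier_vec N \<Longrightarrow> \<exists>Z\<in>carrier_mat m m. T Z \<and> half Z = v"
    and mask: "\<And>Z. Z \<in> carrier_mat m m \<Longrightarrow> T Z \<Longrightarrow> T (Z \<odot>\<^sub>m Theta G)"
    and P_half: "\<And>Z. Z \<in> carrier_mat m m \<Longrightarrow> P *\<^sub>v half Z = half (Z \<odot>\<^sub>m Theta G)"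
    and J_half: "\<And>Z. Z \<in> carrier_mat m m \<Longrightarrow> T Z \<Longrightarrow> vec_stack Z = J *\<^sub>v half Z"
    and norm_half: "\<And>Z. Z \<in> carrier_mat m m \<Longrightarrow> T Z \<Longrightarrow> norm2 (mat_diag N f *\<^sub>v half Z) = frob_norm Z"
  defines "S \<equiv> J * P * inv_mat (mat_diag N f)"
  shows "S \<in> carrier_mat (m * m) N"
    and "isometric_param S {Z. Z \<in> carrier_mat m m \<and> T Z \<and> sparse_in G Z}"
      (is "isometric_param _ ?C")
proof -
  let ?D = "mat_diag N f"
  note inv = inv_mat_diag[of N f, OF f]
  have D: "?D \<in> carrier_mat N N" by simp
  have inv_carrier: "inv_mat ?D \<in> carrier_mat N N" using inv(1)[of "0\<^sub>v N"] by simp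
  show S: "S \<in> carrier_mat (m * m) N" using J P inv_carrier by (simp add: S_def)
  have apply_S: "S *\<^sub>v (?D *\<^sub>v half Z) = vec_stack (Z \<odot>\<^sub>m Theta G)"
    if Z: "Z \<in> carrier_mat m m" "T Z" for Z
  proof -
    have Dv: "?D *\<^sub>v half Z \<in> carrier_vec N" using D half[OF Z(1)] by (rule mult_mat_vec_carrier)
    have "S *\<^sub>v (?D *\<^sub>v half Z) = J *\<^sub>v (P *\<^sub>v (inv_mat ?D *\<^sub>v (?D *\<^sub>v half Z)))"
      unfolding S_def assoc_mult_mat_vec[OF mult_carrier_mat[OF J P] inv_carrier Dv]
      using J P mult_mat_vec_carrier[OF inv_carrier Dv] by (rule assoc_mult_mat_vec)
    also have "\<dots> = J *\<^sub>v half (Z \<odot>\<^sub>m Theta G)"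
      using inv(3)[OF _ half[OF Z(1)]] P_half[OF Z(1)] by simp
    also have "\<dots> = vec_stack (Z \<odot>\<^sub>m Theta G)"
      using J_half[OF _ mask[OF Z]] Z(1) by simp
    finally show ?thesis .
  qed
  show "isometric_param S ?C"
    unfolding isometric_param_def
  proof (intro conjI ballI)
    fix s :: "real vec" assume "s \<in> carrier_vec (dim_col S)"
    hence s: "s \<in> carrier_vec N" using S by simp
    \<comment> \<open>Removing the weights from \<open>s\<close> before choosing \<open>Z\<close>
      makes \<open>s\<close> its weighted half-vector.\<close>
    then obtain Z where Z: "Z \<in> carrier_mat m m" "T Z" and "half Z = inv_mat ?D *\<^sub>v s"
      using surj[OF mult_mat_vec_carrier[OF inv_carrier s]] by auto
    hence s_eq: "?D *\<^sub>v half Z = s" using inv(2)[OF _ s] by simp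
    have "frob_norm (Z \<odot>\<^sub>m Theta G) \<le> norm2 s"
      using frob_norm_hadamard_Theta_le[OF Z(1) G] norm_half[OF Z] s_eq by simp
    thus "\<exists>Z\<in>?C. S *\<^sub>v s = vec_stack Z \<and> frob_norm Z \<le> norm2 s"
      using apply_S[OF Z] s_eq mask[OF Z] Z sparse_in_hadamard_Theta[OF Z(1) G]
      by (intro bexI[of _ "Z \<odot>\<^sub>m Theta G"]) simp_all
  next
    fix Z assume "Z \<in> ?C"
    hence Z: "Z \<in> carrier_mat m m" "T Z" "sparse_in G Z" by auto
    show "\<exists>s\<in>carrier_vec (dim_col S). S *\<^sub>v s = vec_stack Z \<and> norm2 s = frob_norm Z"
    proof
      show "S *\<^sub>v (?D *\<^sub>v half Z) = vec_stack Z \<and> norm2 (?D *\<^sub>v half Z) = frob_norm Z"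
        using apply_S[OF Z(1,2)] norm_half[OF Z(1,2)] Z(3)
        by (simp add: sparse_in_iff_hadamard_Theta[OF Z(1) G])
      show "?D *\<^sub>v half Z \<in> carrier_vec (dim_col S)"
        using mult_mat_vec_carrier[OF D half[OF Z(1)]] S by simp
    qed
  qed
qed

context
  fixes G :: "complex mat" and m :: nat
  assumes G: "G \<in> carrier_mat m m" and herm: "hermitian_mat G"
begin

text \<open>The pattern of \<open>G\<close> is symmetric, so masking treats the entries at
  \<open>(i, j)\<close> and \<open>(j, i)\<close> alike.\<close>

lemma hadamard_Theta_symmetry:
  fixes Z :: "real mat"
  assumes Z: "Z \<in> carrier_mat m m"
  shows "symmetric_mat Z \<Longrightarrow> symmetric_mat (Z \<odot>\<^sub>m Theta G)"
    and "skew_mat Z \<Longrightarrow> skew_mat (Z \<odot>\<^sub>m Theta G)"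
proof -
  have Z': "Z \<odot>\<^sub>m Theta G \<in> carrier_mat m m" using Z by simp
  note index = hadamard_Theta_index[OF Z G]
  note pattern = hermitian_pattern[OF herm G]
  {
    assume sym: "symmetric_mat Z"
    show "symmetric_mat (Z \<odot>\<^sub>m Theta G)"
      unfolding symmetric_mat_iff[OF Z']
    proof (intro allI impI)
      fix i j assume ij: "i < m" "j < m"
      hence "Z $$ (j, i) = Z $$ (i, j)" using sym unfolding symmetric_mat_iff[OF Z] by blast
      thus "(Z \<odot>\<^sub>m Theta G) $$ (j, i) = (Z \<odot>\<^sub>m Theta G) $$ (i, j)"
        unfolding index[OF ij] index[OF ij(2,1)] using pattern[OF ij] by simp
    qed
  next
    assume skew: "skew_mat Z"
    show "skew_mat (Z \<odot>\<^sub>m Theta G)"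
      unfolding skew_mat_iff[OF Z']
    proof (intro allI impI)
      fix i j assume ij: "i < m" "j < m"
      hence "Z $$ (j, i) = - Z $$ (i, j)" using skew unfolding skew_mat_iff[OF Z] by blast
      thus "(Z \<odot>\<^sub>m Theta G) $$ (j, i) = - (Z \<odot>\<^sub>m Theta G) $$ (i, j)"
        unfolding index[OF ij] index[OF ij(2,1)] using pattern[OF ij] by simp
    qed
  }
qed

lemma isometric_param_S1_mat:
  "S1_mat G \<in> carrier_mat (m * m) (m * (m + 1) div 2)"
  "isometric_param (S1_mat G) {Z. Z \<in> carrier_mat m m \<and> symmetric_mat Z \<and> sparse_in G Z}"
proof -
  let ?N = "length (lower_pairs m)"
  let ?w = "\<lambda>c. if fst (lower_pairs m ! c) = snd (lower_pairs m ! c) then 1 else sqrt 2"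
  have J: "J_S m \<in> carrier_mat (m * m) ?N"
    using J_S_spec[of m] by (simp add: power2_eq_square length_lower_pairs)
  have P: "Phi_mat G \<in> carrier_mat ?N ?N"
    using G by (simp add: Phi_mat_def diag_of_vec_def Theta_def)
  have w: "?w c \<noteq> 0" if "c < ?N" for c by simp
  have half: "vec_S Z \<in> carrier_vec ?N" if "Z \<in> carrier_mat m m" for Z :: "real mat"
    using that by (intro carrier_vecI) simp
  have surj: "\<exists>Z\<in>carrier_mat m m. symmetric_mat Z \<and> vec_S Z = v"
    if "v \<in> carrier_vec ?N" for v :: "real vec"
    using ex_vec_S[OF that] by blast
  have J_half: "vec_stack Z = J_S m *\<^sub>v vec_S Z"
    if "Z \<in> carrier_mat m m" "symmetric_mat Z" for Z
    using that J_S_spec[of m] by (simp add: symmetric_mat_def)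
  have norm_half: "norm2 (mat_diag ?N ?w *\<^sub>v vec_S Z) = frob_norm Z"
    if "Z \<in> carrier_mat m m" "symmetric_mat Z" for Z
    using norm2_D_S_vec_S[OF that] by (simp only: D_S_eq)
  note facts = J P G w half surj hadamard_Theta_symmetry(1) Phi_mat_mult_vec_S[OF _ G] J_half norm_half
  have "J_S m * Phi_mat G * inv_mat (mat_diag ?N ?w) \<in> carrier_mat (m * m) ?N"
    by (rule isometric_param_half_vectorization(1)[of _ m ?N _ G ?w vec_S symmetric_mat]; fact facts)
  moreover have "isometric_param (J_S m * Phi_mat G * inv_mat (mat_diag ?N ?w))
      {Z. Z \<in> carrier_mat m m \<and> symmetric_mat Z \<and> sparse_in G Z}"
    by (rule isometric_param_half_vectorization(2)[of _ m ?N _ G ?w vec_S symmetric_mat]; fact facts)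
  ultimately show "S1_mat G \<in> carrier_mat (m * m) (m * (m + 1) div 2)"
    "isometric_param (S1_mat G) {Z. Z \<in> carrier_mat m m \<and> symmetric_mat Z \<and> sparse_in G Z}"
    using G by (simp_all add: S1_mat_def D_S_eq length_lower_pairs)
qed

lemma isometric_param_S2_mat:
  "S2_mat G \<in> carrier_mat (m * m) (m * (m - 1) div 2)"
  "isometric_param (S2_mat G) {Z. Z \<in> carrier_mat m m \<and> skew_mat Z \<and> sparse_in G Z}"
proof -
  let ?N = "length (strict_lower_pairs m)"
  let ?w = "\<lambda>_::nat. sqrt 2"
  have J: "J_SK m \<in> carrier_mat (m * m) ?N"
    using J_SK_spec[of m] by (simp add: power2_eq_square length_strict_lower_pairs)
  have P: "Psi_mat G \<in> carrier_mat ?N ?N"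
    using G by (simp add: Psi_mat_def diag_of_vec_def strict_upper_pairs_eq)
  have w: "?w c \<noteq> 0" if "c < ?N" for c by simp
  have half: "vec_SK Z \<in> carrier_vec ?N" if "Z \<in> carrier_mat m m" for Z :: "real mat"
    using that by (intro carrier_vecI) simp
  have surj: "\<exists>Z\<in>carrier_mat m m. skew_mat Z \<and> vec_SK Z = v"
    if "v \<in> carrier_vec ?N" for v :: "real vec"
    using ex_vec_SK[OF that] by blast
  have J_half: "vec_stack Z = J_SK m *\<^sub>v vec_SK Z"
    if "Z \<in> carrier_mat m m" "skew_mat Z" for Z
    using that J_SK_spec[of m] by (simp add: skew_mat_def)
  have norm_half: "norm2 (mat_diag ?N ?w *\<^sub>v vec_SK Z) = frob_norm Z"
    if "Z \<in> carrier_mat m m" "skew_mat Z" for Z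
    using norm2_D_SK_vec_SK[OF that] by (simp only: D_SK_eq)
  note facts = J P G w half surj hadamard_Theta_symmetry(2) Psi_mat_mult_vec_SK[OF _ G herm] J_half norm_half
  have "J_SK m * Psi_mat G * inv_mat (mat_diag ?N ?w) \<in> carrier_mat (m * m) ?N"
    by (rule isometric_param_half_vectorization(1)[of _ m ?N _ G ?w vec_SK skew_mat]; fact facts)
  moreover have "isometric_param (J_SK m * Psi_mat G * inv_mat (mat_diag ?N ?w))
      {Z. Z \<in> carrier_mat m m \<and> skew_mat Z \<and> sparse_in G Z}"
    by (rule isometric_param_half_vectorization(2)[of _ m ?N _ G ?w vec_SK skew_mat]; fact facts)
  ultimately show "S2_mat G \<in> carrier_mat (m * m) (m * (m - 1) div 2)"
    "isometric_param (S2_mat G) {Z. Z \<in> carrier_mat m m \<and> skew_mat Z \<and> sparse_in G Z}"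
    using G by (simp_all add: S2_mat_def D_SK_eq length_strict_lower_pairs)
qed

end

section \<open>Kronecker products and appended blocks acting on vectors\<close>

lemma scalar_prod_vec_stack:
  fixes A :: "'a::semiring_0 mat"
  assumes "w \<in> carrier_vec (dim_row A * dim_col A)"
    and "\<And>x. x < dim_row A * dim_col A \<Longrightarrow> w $ x = h (x mod dim_row A) (x div dim_row A)"
  shows "w \<bullet> vec_stack A = (\<Sum>j<dim_col A. \<Sum>i<dim_row A. h i j * A $$ (i, j))"
proof -
  have "w \<bullet> vec_stack A = (\<Sum>x<dim_row A * dim_col A.
      h (x mod dim_row A) (x div dim_row A) * A $$ (x mod dim_row A, x div dim_row A))"
    using assms by (auto simp: scalar_prod_def vec_stack_index atLeast0LessThan intro!: sum.cong)
  thus ?thesis using sum_mod_div[of "\<lambda>i j. h i j * A $$ (i, j)"] by simp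
qed

lemma kronecker_dim [simp]:
  "dim_row (A \<otimes>\<^sub>k B) = dim_row A * dim_row B" "dim_col (A \<otimes>\<^sub>k B) = dim_col A * dim_col B"
  by (simp_all add: kronecker_def)

text \<open>In row \<open>i\<close> of the Kronecker product the entry at position \<open>x\<close>
  is \<open>v $ (x div r)\<close> if \<open>x mod r = i\<close> and zero otherwise, so the inner sum
  picks row \<open>i\<close> of \<open>A\<close>.\<close>

lemma kronecker_row_one_mult_vec_stack:
  fixes A :: "'a::comm_semiring_1 mat"
  assumes A: "A \<in> carrier_mat r c" and v: "v \<in> carrier_vec c"
  shows "(mat_of_row v \<otimes>\<^sub>k 1\<^sub>m r) *\<^sub>v vec_stack A = A *\<^sub>v v"
proof (rule eq_vecI)
  let ?K = "mat_of_row v \<otimes>\<^sub>k 1\<^sub>m r"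
  have dim: "dim_row A = r" "dim_col A = c" "dim_vec v = c" using A v by auto
  fix i assume "i < dim_vec (A *\<^sub>v v)"
  hence i: "i < r" using A by simp
  have "row ?K i \<bullet> vec_stack A = (\<Sum>j<dim_col A. \<Sum>i'<dim_row A. (v $ j * (if i = i' then 1 else 0)) * A $$ (i', j))"
  proof (rule scalar_prod_vec_stack[where h = "\<lambda>i' j. v $ j * (if i = i' then 1 else 0)"])
    show "row ?K i \<in> carrier_vec (dim_row A * dim_col A)"
      by (rule carrier_vecI) (simp add: dim)
    fix x assume "x < dim_row A * dim_col A"
    hence x: "x < r * c" by (simp add: dim)
    show "row ?K i $ x = v $ (x div dim_row A) * (if i = x mod dim_row A then 1 else 0)"
      using i x mod_div_less[OF x] by (simp add: dim kronecker_def mult.commute)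
  qed
  also have "\<dots> = (\<Sum>j<c. v $ j * A $$ (i, j))"
  proof -
    have "(\<Sum>i'<r. (v $ j * (if i = i' then 1 else 0)) * A $$ (i', j))
        = (\<Sum>i'<r. if i' = i then v $ j * A $$ (i', j) else 0)" for j
      by (rule sum.cong) auto
    thus ?thesis using i by (simp add: dim)
  qed
  also have "\<dots> = (A *\<^sub>v v) $ i"
    using i by (simp add: dim scalar_prod_def atLeast0LessThan mult.commute)
  finally show "(?K *\<^sub>v vec_stack A) $ i = (A *\<^sub>v v) $ i"
    using i by simp
qed (use A in simp)

text \<open>Here row \<open>j\<close> of the Kronecker product selects column \<open>j\<close> of
  \<open>A\<close> and contracts it with \<open>v\<close>. This yields a transpose, not an adjoint;
  the conjugation in the \<open>F\<close> block comes from the signs in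
  \<open>K1_hat\<close>.\<close>

lemma kronecker_one_row_mult_vec_stack:
  fixes A :: "'a::comm_semiring_1 mat"
  assumes A: "A \<in> carrier_mat r c" and v: "v \<in> carrier_vec r"
  shows "(1\<^sub>m c \<otimes>\<^sub>k mat_of_row v) *\<^sub>v vec_stack A = transpose_mat A *\<^sub>v v"
proof (rule eq_vecI)
  let ?K = "1\<^sub>m c \<otimes>\<^sub>k mat_of_row v"
  have dim: "dim_row A = r" "dim_col A = c" "dim_vec v = r" using A v by auto
  fix j assume "j < dim_vec (transpose_mat A *\<^sub>v v)"
  hence j: "j < c" using A by simp
  have "row ?K j \<bullet> vec_stack A = (\<Sum>j'<dim_col A. \<Sum>i<dim_row A. ((if j = j' then 1 else 0) * v $ i) * A $$ (i, j'))"
  proof (rule scalar_prod_vec_stack[where h = "\<lambda>i j'. (if j = j' then 1 else 0) * v $ i"])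
    show "row ?K j \<in> carrier_vec (dim_row A * dim_col A)"
      by (rule carrier_vecI) (simp add: dim)
    fix x assume "x < dim_row A * dim_col A"
    hence x: "x < r * c" by (simp add: dim)
    show "row ?K j $ x = (if j = x div dim_row A then 1 else 0) * v $ (x mod dim_row A)"
      using j x mod_div_less[OF x] by (simp add: dim kronecker_def mult.commute)
  qed
  also have "\<dots> = (\<Sum>j'<c. if j' = j then (\<Sum>i<r. v $ i * A $$ (i, j')) else 0)"
    unfolding dim by (rule sum.cong) auto
  also have "\<dots> = (transpose_mat A *\<^sub>v v) $ j"
    using j by (simp add: dim scalar_prod_def atLeast0LessThan mult.commute)
  finally show "(?K *\<^sub>v vec_stack A) $ j = (transpose_mat A *\<^sub>v v) $ j"
    using j by simp
qed (use A in simp)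

lemma smult_mat_mult_vec:
  assumes "A \<in> carrier_mat r c" "v \<in> carrier_vec c"
  shows "(k \<cdot>\<^sub>m A) *\<^sub>v v = k \<cdot>\<^sub>v (A *\<^sub>v (v :: 'a::comm_semiring_0 vec))"
  using assms by (intro eq_vecI) (simp_all add: scalar_prod_def sum_distrib_left mult.assoc)

lemma append_cols_carrier [intro]:
  "A \<in> carrier_mat r a \<Longrightarrow> B \<in> carrier_mat r b \<Longrightarrow> A @\<^sub>c B \<in> carrier_mat r (a + b)"
  by (rule carrier_matI) (auto simp: append_cols_def)

text \<open>\<open>append_cols\<close> is a four-block matrix whose lower blocks have no rows, so
  the four-block product rule applies and its lower part is empty.\<close>

lemma append_cols_mult_vec:
  assumes A: "A \<in> carrier_mat r a" and B: "B \<in> carrier_mat r b"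
    and x: "x \<in> carrier_vec a" and y: "y \<in> carrier_vec b"
  shows "(A @\<^sub>c B) *\<^sub>v (x @\<^sub>v y) = A *\<^sub>v x + B *\<^sub>v (y :: 'a::comm_semiring_0 vec)"
proof -
  have "(A @\<^sub>c B) *\<^sub>v (x @\<^sub>v y)
      = (A *\<^sub>v x + B *\<^sub>v y) @\<^sub>v (0\<^sub>m 0 a *\<^sub>v x + 0\<^sub>m 0 b *\<^sub>v y)"
    unfolding append_cols_def carrier_matD(2)[OF A] carrier_matD(2)[OF B]
    by (rule four_block_mat_mult_vec[OF A B _ _ x y]) auto
  thus ?thesis using A B by (intro eq_vecI) auto
qed

lemma append_vec_assoc: "(x @\<^sub>v y) @\<^sub>v z = x @\<^sub>v (y @\<^sub>v z)"
proof (rule eq_vecI)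
  fix i assume i: "i < dim_vec (x @\<^sub>v (y @\<^sub>v z))"
  have "i - dim_vec x < dim_vec y \<longleftrightarrow> i < dim_vec x + dim_vec y" if "\<not> i < dim_vec x"
    using that by arith
  thus "((x @\<^sub>v y) @\<^sub>v z) $ i = (x @\<^sub>v (y @\<^sub>v z)) $ i"
    using i by simp
qed simp

lemma norm2_append: "(norm2 (x @\<^sub>v y))\<^sup>2 = (norm2 x)\<^sup>2 + (norm2 y)\<^sup>2"
proof -
  let ?a = "dim_vec x" and ?b = "dim_vec y" and ?f = "\<lambda>i. (norm ((x @\<^sub>v y) $ i))\<^sup>2"
  have "sum ?f {0..<?a + ?b} = sum ?f {0..<?a} + sum ?f {?a..<?a + ?b}"
    by (rule sum.atLeastLessThan_concat[symmetric]) auto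
  also have "sum ?f {?a..<?a + ?b} = (\<Sum>i = 0..<?b. ?f (i + ?a))"
    using sum.shift_bounds_nat_ivl[of ?f 0 ?a ?b] by (simp only: add_0_left add.commute)
  finally show ?thesis by (simp add: norm2_power2 atLeast0LessThan)
qed

section \<open>Passing between complex objects and pairs of real ones\<close>

text \<open>The scalar \<open>k\<close> undoes a weight: taken as the inverse of a weight, it
  rebuilds a complex matrix from its weighted real and imaginary parts.\<close>

definition complex_mat :: "real \<Rightarrow> real mat \<Rightarrow> real mat \<Rightarrow> complex mat" where
  "complex_mat k A B = mat (dim_row A) (dim_col A) (\<lambda>ij. Complex (k * A $$ ij) (k * B $$ ij))"

definition complex_vec :: "real \<Rightarrow> real vec \<Rightarrow> real vec \<Rightarrow> complex vec" where
  "complex_vec k x y = vec (dim_vec x) (\<lambda>i. Complex (k * x $ i) (k * y $ i))"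

lemma complex_mat_carrier [simp]: "complex_mat k A B \<in> carrier_mat r c \<longleftrightarrow> A \<in> carrier_mat r c"
  unfolding carrier_mat_def by (simp only: complex_mat_def mem_Collect_eq dim_row_mat dim_col_mat)

lemma complex_vec_carrier [simp]: "complex_vec k x y \<in> carrier_vec n \<longleftrightarrow> x \<in> carrier_vec n"
  unfolding carrier_vec_def by (simp only: complex_vec_def mem_Collect_eq dim_vec)

lemma Re_Im_complex_mat:
  assumes "A \<in> carrier_mat r c" "B \<in> carrier_mat r c"
  shows "Re_mat (complex_mat k A B) = k \<cdot>\<^sub>m A" "Im_mat (complex_mat k A B) = k \<cdot>\<^sub>m B"
  using assms by (auto simp: complex_mat_def)

lemma Re_Im_complex_vec:
  assumes "x \<in> carrier_vec n" "y \<in> carrier_vec n"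
  shows "Re_vec (complex_vec k x y) = k \<cdot>\<^sub>v x" "Im_vec (complex_vec k x y) = k \<cdot>\<^sub>v y"
  using assms by (auto simp: complex_vec_def)

lemma complex_mat_Re_Im:
  assumes "k \<noteq> 0"
  shows "complex_mat (inverse k) (k \<cdot>\<^sub>m Re_mat A) (k \<cdot>\<^sub>m Im_mat A) = A"
  using assms by (intro eq_matI) (simp_all add: complex_mat_def complex_eq_iff)

lemma complex_vec_Re_Im:
  assumes "k \<noteq> 0"
  shows "complex_vec (inverse k) (k \<cdot>\<^sub>v Re_vec x) (k \<cdot>\<^sub>v Im_vec x) = x"
  using assms by (intro eq_vecI) (simp_all add: complex_vec_def complex_eq_iff)

lemma frob_norm_complex_mat:
  assumes "A \<in> carrier_mat r c" "B \<in> carrier_mat r c"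
  shows "(frob_norm (complex_mat k A B))\<^sup>2 = k\<^sup>2 * ((frob_norm A)\<^sup>2 + (frob_norm B)\<^sup>2)"
  using assms unfolding frob_norm_power2
  by (simp add: complex_mat_def cmod_power2 power_mult_distrib sum.distrib sum_distrib_left distrib_left)

lemma norm2_complex_vec:
  assumes "x \<in> carrier_vec n" "y \<in> carrier_vec n"
  shows "(norm2 (complex_vec k x y))\<^sup>2 = k\<^sup>2 * ((norm2 x)\<^sup>2 + (norm2 y)\<^sup>2)"
  using assms unfolding norm2_power2
  by (simp add: complex_vec_def cmod_power2 power_mult_distrib sum.distrib sum_distrib_left distrib_left)

lemma Re_Im_mult_mat_vec:
  assumes "A \<in> carrier_mat r c" "v \<in> carrier_vec c"
  shows "Re_vec (A *\<^sub>v v) = Re_mat A *\<^sub>v Re_vec v - Im_mat A *\<^sub>v Im_vec v"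
    and "Im_vec (A *\<^sub>v v) = Re_mat A *\<^sub>v Im_vec v + Im_mat A *\<^sub>v Re_vec v"
  using assms by (intro eq_vecI; simp add: scalar_prod_def sum_subtractf sum.distrib)+

lemma Re_Im_mat_adjoint:
  "Re_mat (mat_adjoint A) = transpose_mat (Re_mat A)"
  "Im_mat (mat_adjoint A) = - transpose_mat (Im_mat A)"
  by (intro eq_matI; simp)+

lemma hermitian_complex_mat:
  assumes A: "A \<in> carrier_mat k k" and B: "B \<in> carrier_mat k k" and "symmetric_mat A" "skew_mat B"
  shows "hermitian_mat (complex_mat l A B)"
proof -
  have H: "complex_mat l A B \<in> carrier_mat k k" using A by simp
  show ?thesis
    unfolding hermitian_mat_iff[OF H]
  proof (intro allI impI)
    fix i j assume ij: "i < k" "j < k"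
    hence "A $$ (j, i) = A $$ (i, j)" "B $$ (j, i) = - B $$ (i, j)"
      using assms(3,4) unfolding symmetric_mat_iff[OF A] skew_mat_iff[OF B] by blast+
    thus "complex_mat l A B $$ (j, i) = cnj (complex_mat l A B $$ (i, j))"
      using ij A B by (simp add: complex_mat_def complex_eq_iff)
  qed
qed

lemma symmetry_smult_Re_Im_hermitian:
  assumes A: "A \<in> carrier_mat k k" and herm: "hermitian_mat A"
  shows "symmetric_mat (l \<cdot>\<^sub>m Re_mat A)" "skew_mat (l \<cdot>\<^sub>m Im_mat A)"
proof -
  have R: "l \<cdot>\<^sub>m Re_mat A \<in> carrier_mat k k" and I: "l \<cdot>\<^sub>m Im_mat A \<in> carrier_mat k k" using A by auto
  have h: "A $$ (j, i) = cnj (A $$ (i, j))" if "i < k" "j < k" for i j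
    using herm that unfolding hermitian_mat_iff[OF A] by blast
  show "symmetric_mat (l \<cdot>\<^sub>m Re_mat A)"
    unfolding symmetric_mat_iff[OF R]
  proof (intro allI impI)
    fix i j assume ij: "i < k" "j < k"
    show "(l \<cdot>\<^sub>m Re_mat A) $$ (j, i) = (l \<cdot>\<^sub>m Re_mat A) $$ (i, j)" using A ij arg_cong[OF h[OF ij], of Re] by simp
  qed
  show "skew_mat (l \<cdot>\<^sub>m Im_mat A)"
    unfolding skew_mat_iff[OF I]
  proof (intro allI impI)
    fix i j assume ij: "i < k" "j < k"
    show "(l \<cdot>\<^sub>m Im_mat A) $$ (j, i) = - (l \<cdot>\<^sub>m Im_mat A) $$ (i, j)" using A ij arg_cong[OF h[OF ij], of Im] by simp
  qed
qed

lemma sparse_in_complex_mat: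
  assumes "A \<in> carrier_mat r c" "B \<in> carrier_mat r c" "sparse_in X A" "sparse_in X B"
  shows "sparse_in X (complex_mat k A B)"
  using assms by (auto simp: sparse_in_def complex_mat_def complex_eq_iff)

lemma sparse_in_smult_Re_Im:
  assumes "sparse_in X A"
  shows "sparse_in X (k \<cdot>\<^sub>m Re_mat A)" "sparse_in X (k \<cdot>\<^sub>m Im_mat A)"
  using assms by (auto simp: sparse_in_def)

section \<open>The blocks of the coefficient matrix\<close>

lemma uminus_mult_mat_vec_carrier:
  "A \<in> carrier_mat r c \<Longrightarrow> v \<in> carrier_vec c \<Longrightarrow> (- A) *\<^sub>v v = - (A *\<^sub>v (v :: 'a::ring vec))"
  by simp

text \<open>Stated for any \<open>S\<close> that maps \<open>s\<close> to a stacked matrix, so that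
  it serves \<open>Sigma_mat\<close>, \<open>S1_mat\<close> and \<open>S2_mat\<close> alike.\<close>

lemma scaled_kronecker_row_one_mult:
  fixes A :: "'a::comm_ring_1 mat"
  assumes S: "S \<in> carrier_mat (r * c) l" and s: "s \<in> carrier_vec l" and Ss: "S *\<^sub>v s = vec_stack A"
    and A: "A \<in> carrier_mat r c" and v: "v \<in> carrier_vec c"
  shows "k \<cdot>\<^sub>m ((mat_of_row v \<otimes>\<^sub>k 1\<^sub>m r) * S) \<in> carrier_mat r l"
    "(k \<cdot>\<^sub>m ((mat_of_row v \<otimes>\<^sub>k 1\<^sub>m r) * S)) *\<^sub>v s = (k \<cdot>\<^sub>m A) *\<^sub>v v"
proof -
  have K: "mat_of_row v \<otimes>\<^sub>k 1\<^sub>m r \<in> carrier_mat r (r * c)"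
    using v by (intro carrier_matI) simp_all
  have KS: "(mat_of_row v \<otimes>\<^sub>k 1\<^sub>m r) * S \<in> carrier_mat r l" using K S by (rule mult_carrier_mat)
  thus "k \<cdot>\<^sub>m ((mat_of_row v \<otimes>\<^sub>k 1\<^sub>m r) * S) \<in> carrier_mat r l" by (rule smult_carrier_mat)
  show "(k \<cdot>\<^sub>m ((mat_of_row v \<otimes>\<^sub>k 1\<^sub>m r) * S)) *\<^sub>v s = (k \<cdot>\<^sub>m A) *\<^sub>v v"
    unfolding smult_mat_mult_vec[OF KS s] smult_mat_mult_vec[OF A v] assoc_mult_mat_vec[OF K S s] Ss
      kronecker_row_one_mult_vec_stack[OF A v] ..
qed

lemma scaled_kronecker_one_row_mult:
  fixes A :: "'a::comm_ring_1 mat"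
  assumes S: "S \<in> carrier_mat (r * c) l" and s: "s \<in> carrier_vec l" and Ss: "S *\<^sub>v s = vec_stack A"
    and A: "A \<in> carrier_mat r c" and v: "v \<in> carrier_vec r"
  shows "k \<cdot>\<^sub>m ((1\<^sub>m c \<otimes>\<^sub>k mat_of_row v) * S) \<in> carrier_mat c l"
    "(k \<cdot>\<^sub>m ((1\<^sub>m c \<otimes>\<^sub>k mat_of_row v) * S)) *\<^sub>v s = transpose_mat (k \<cdot>\<^sub>m A) *\<^sub>v v"
proof -
  have K: "1\<^sub>m c \<otimes>\<^sub>k mat_of_row v \<in> carrier_mat c (r * c)"
    using v by (intro carrier_matI) simp_all
  have KS: "(1\<^sub>m c \<otimes>\<^sub>k mat_of_row v) * S \<in> carrier_mat c l" using K S by (rule mult_carrier_mat)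
  thus "k \<cdot>\<^sub>m ((1\<^sub>m c \<otimes>\<^sub>k mat_of_row v) * S) \<in> carrier_mat c l" by (rule smult_carrier_mat)
  have At: "transpose_mat A \<in> carrier_mat c r" using A by simp
  have "transpose_mat (k \<cdot>\<^sub>m A) = k \<cdot>\<^sub>m transpose_mat A" by (rule eq_matI) auto
  thus "(k \<cdot>\<^sub>m ((1\<^sub>m c \<otimes>\<^sub>k mat_of_row v) * S)) *\<^sub>v s = transpose_mat (k \<cdot>\<^sub>m A) *\<^sub>v v"
    unfolding smult_mat_mult_vec[OF KS s] assoc_mult_mat_vec[OF K S s] Ss
      kronecker_one_row_mult_vec_stack[OF A v] by (simp only: smult_mat_mult_vec[OF At v])
qed

lemma two_by_four_mult_vec:
  fixes x1 :: "'a::comm_semiring_0 vec"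
  assumes A: "A1 \<in> carrier_mat r n1" "A2 \<in> carrier_mat r n2" "A3 \<in> carrier_mat r n3" "A4 \<in> carrier_mat r n4"
    and B: "B1 \<in> carrier_mat s n1" "B2 \<in> carrier_mat s n2" "B3 \<in> carrier_mat s n3" "B4 \<in> carrier_mat s n4"
    and x: "x1 \<in> carrier_vec n1" "x2 \<in> carrier_vec n2" "x3 \<in> carrier_vec n3" "x4 \<in> carrier_vec n4"
  shows "((A1 @\<^sub>c A2 @\<^sub>c A3 @\<^sub>c A4) @\<^sub>r (B1 @\<^sub>c B2 @\<^sub>c B3 @\<^sub>c B4)) *\<^sub>v (x1 @\<^sub>v x2 @\<^sub>v x3 @\<^sub>v x4)
      = (A1 *\<^sub>v x1 + (A2 *\<^sub>v x2 + (A3 *\<^sub>v x3 + A4 *\<^sub>v x4)))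
        @\<^sub>v (B1 *\<^sub>v x1 + (B2 *\<^sub>v x2 + (B3 *\<^sub>v x3 + B4 *\<^sub>v x4)))"
proof -
  have A34: "A3 @\<^sub>c A4 \<in> carrier_mat r (n3 + n4)" and B34: "B3 @\<^sub>c B4 \<in> carrier_mat s (n3 + n4)"
    using A B by auto
  have A234: "A2 @\<^sub>c A3 @\<^sub>c A4 \<in> carrier_mat r (n2 + (n3 + n4))"
    and B234: "B2 @\<^sub>c B3 @\<^sub>c B4 \<in> carrier_mat s (n2 + (n3 + n4))"
    using A B A34 B34 by auto
  have A1234: "A1 @\<^sub>c A2 @\<^sub>c A3 @\<^sub>c A4 \<in> carrier_mat r (n1 + (n2 + (n3 + n4)))"
    and B1234: "B1 @\<^sub>c B2 @\<^sub>c B3 @\<^sub>c B4 \<in> carrier_mat s (n1 + (n2 + (n3 + n4)))"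
    using A B A234 B234 by auto
  have x34: "x3 @\<^sub>v x4 \<in> carrier_vec (n3 + n4)" using x by simp
  have x234: "x2 @\<^sub>v x3 @\<^sub>v x4 \<in> carrier_vec (n2 + (n3 + n4))" using x x34 by simp
  have x1234: "x1 @\<^sub>v x2 @\<^sub>v x3 @\<^sub>v x4 \<in> carrier_vec (n1 + (n2 + (n3 + n4)))" using x x234 by simp
  show "((A1 @\<^sub>c A2 @\<^sub>c A3 @\<^sub>c A4) @\<^sub>r (B1 @\<^sub>c B2 @\<^sub>c B3 @\<^sub>c B4)) *\<^sub>v (x1 @\<^sub>v x2 @\<^sub>v x3 @\<^sub>v x4)
      = (A1 *\<^sub>v x1 + (A2 *\<^sub>v x2 + (A3 *\<^sub>v x3 + A4 *\<^sub>v x4)))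
        @\<^sub>v (B1 *\<^sub>v x1 + (B2 *\<^sub>v x2 + (B3 *\<^sub>v x3 + B4 *\<^sub>v x4)))"
    unfolding mat_mult_append[OF A1234 B1234 x1234]
      append_cols_mult_vec[OF A(1) A234 x(1) x234] append_cols_mult_vec[OF A(2) A34 x(2) x34]
      append_cols_mult_vec[OF A(3,4) x(3,4)]
      append_cols_mult_vec[OF B(1) B234 x(1) x234] append_cols_mult_vec[OF B(2) B34 x(2) x34]
      append_cols_mult_vec[OF B(3,4) x(3,4)] ..
qed

lemma Re_Im_vec_add:
  assumes "x \<in> carrier_vec n" "y \<in> carrier_vec n"
  shows "Re_vec (x + y) = Re_vec x + Re_vec y" "Im_vec (x + y) = Im_vec x + Im_vec y"
  using assms by (intro eq_vecI; simp)+

lemma Re_Im_vec_carrier: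
  "x \<in> carrier_vec n \<Longrightarrow> Re_vec x \<in> carrier_vec n" "x \<in> carrier_vec n \<Longrightarrow> Im_vec x \<in> carrier_vec n"
  by simp_all

lemma mat_adjoint_carrier: "A \<in> carrier_mat r c \<Longrightarrow> mat_adjoint A \<in> carrier_mat c r"
  by (intro carrier_matI) simp_all

text \<open>The sign patterns of the real and imaginary rows: the first two belong to
  \<open>K1_hat\<close>, where the adjoint flips the imaginary part of the \<open>F\<close> block
  and produces the double minus, the last two to \<open>K2_hat\<close>.\<close>

lemma vec_sum_rearrange:
  fixes a b c d :: "'a::ab_group_add vec"
  assumes "a \<in> carrier_vec n" "b \<in> carrier_vec n" "c \<in> carrier_vec n" "d \<in> carrier_vec n"
  shows "a + (- b + (c + d)) = (a - b) + (c - - d)"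
    and "a + (b + (c + - d)) = (a + b) + (c + - d)"
    and "a + (- b + (c + - d)) = (a - b) + (c - d)"
    and "a + (b + (c + d)) = (a + b) + (c + d)"
  using assms by (intro eq_vecI; simp)+

context
  fixes n m :: nat and u p :: "complex vec" and \<alpha>1 \<alpha>2 \<alpha>3 :: real
  assumes u: "u \<in> carrier_vec n" and p: "p \<in> carrier_vec m"
begin

lemma K1_hat_carrier:
  assumes E: "E \<in> carrier_mat n n" and F: "F \<in> carrier_mat m n"
  shows "K1_hat n \<alpha>1 \<alpha>2 E F u p \<in> carrier_mat (2 * n) (n * n + (n * n + (m * n + m * n)))"
  using carrier_matD[OF Sigma_mat_carrier[OF E]] carrier_matD[OF Sigma_mat_carrier[OF F]]
  by (intro carrier_matI) (simp_all add: K1_hat_def Let_def append_rows_def append_cols_def)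

lemma K2_hat_carrier:
  assumes F: "F \<in> carrier_mat m n"
    and "S1_mat G \<in> carrier_mat (m * m) l1" "S2_mat G \<in> carrier_mat (m * m) l2"
  shows "K2_hat m \<alpha>2 \<alpha>3 F G u p \<in> carrier_mat (2 * m) (m * n + (m * n + (l1 + l2)))"
  using carrier_matD[OF Sigma_mat_carrier[OF F]] carrier_matD[OF assms(2)] carrier_matD[OF assms(3)]
  by (intro carrier_matI) (simp_all add: K2_hat_def Let_def append_rows_def append_cols_def)

text \<open>\<open>K1_hat\<close> is the real form of the map sending a perturbation of
  \<open>E\<close> and \<open>F\<close> to its contribution to the first block row. The block signs
  are those of complex multiplication, with the imaginary part of the \<open>F\<close> block negated
  by the adjoint.\<close>

lemma K1_hat_mult_vec:
  assumes E: "E \<in> carrier_mat n n" and F: "F \<in> carrier_mat m n"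
    and x: "a \<in> carrier_vec (n * n)" "b \<in> carrier_vec (n * n)" "c \<in> carrier_vec (m * n)" "d \<in> carrier_vec (m * n)"
    and X: "A \<in> carrier_mat n n" "B \<in> carrier_mat n n" "C \<in> carrier_mat m n" "D \<in> carrier_mat m n"
    and S: "Sigma_mat E *\<^sub>v a = vec_stack A" "Sigma_mat E *\<^sub>v b = vec_stack B"
      "Sigma_mat F *\<^sub>v c = vec_stack C" "Sigma_mat F *\<^sub>v d = vec_stack D"
  defines "w \<equiv> complex_mat (inverse \<alpha>1) A B *\<^sub>v u + mat_adjoint (complex_mat (inverse \<alpha>2) C D) *\<^sub>v p"
  shows "K1_hat n \<alpha>1 \<alpha>2 E F u p *\<^sub>v (a @\<^sub>v b @\<^sub>v c @\<^sub>v d) = Re_vec w @\<^sub>v Im_vec w"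
proof -
  note ru = Re_Im_vec_carrier(1)[OF u] and iu = Re_Im_vec_carrier(2)[OF u]
    and rp = Re_Im_vec_carrier(1)[OF p] and ip = Re_Im_vec_carrier(2)[OF p]
  note SE = Sigma_mat_carrier[OF E] and SF = Sigma_mat_carrier[OF F]
  note row = scaled_kronecker_row_one_mult[OF SE x(1) S(1) X(1)] scaled_kronecker_row_one_mult[OF SE x(2) S(2) X(2)]
  note one = scaled_kronecker_one_row_mult[OF SF x(3) S(3) X(3)] scaled_kronecker_one_row_mult[OF SF x(4) S(4) X(4)]
  let ?dE = "complex_mat (inverse \<alpha>1) A B" and ?dF = "complex_mat (inverse \<alpha>2) C D"
  have dE: "?dE \<in> carrier_mat n n" and dF: "?dF \<in> carrier_mat m n" using X by simp_all
  note dFt = mat_adjoint_carrier[OF dF]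
  note carriers = row(1)[OF ru] uminus_carrier_mat[OF row(1)[OF iu]] one(1)[OF rp] one(1)[OF ip]
    row(1)[OF iu] row(1)[OF ru] one(1)[OF ip] uminus_carrier_mat[OF one(1)[OF rp]]
  \<comment> \<open>The instantiations fix, in block order, the scale factors that
    \<open>carriers\<close> leaves open.\<close>
  note mult = two_by_four_mult_vec[OF carriers x, of "inverse \<alpha>1" "inverse \<alpha>1" "inverse \<alpha>2" "inverse \<alpha>2" "inverse \<alpha>1" "inverse \<alpha>1" "inverse \<alpha>2" "inverse \<alpha>2"]
  have Re: "Re_vec w = (inverse \<alpha>1 \<cdot>\<^sub>m A) *\<^sub>v Re_vec u - (inverse \<alpha>1 \<cdot>\<^sub>m B) *\<^sub>v Im_vec u
      + (transpose_mat (inverse \<alpha>2 \<cdot>\<^sub>m C) *\<^sub>v Re_vec p - - (transpose_mat (inverse \<alpha>2 \<cdot>\<^sub>m D) *\<^sub>v Im_vec p))"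
    using dE dFt u p X unfolding w_def
    by (simp add: Re_Im_vec_add[of _ n] Re_Im_mult_mat_vec[OF dE u] Re_Im_mult_mat_vec[OF dFt p]
        Re_Im_mat_adjoint Re_Im_complex_mat[OF X(1,2)] Re_Im_complex_mat[OF X(3,4)])
  have Im: "Im_vec w = (inverse \<alpha>1 \<cdot>\<^sub>m A) *\<^sub>v Im_vec u + (inverse \<alpha>1 \<cdot>\<^sub>m B) *\<^sub>v Re_vec u
      + (transpose_mat (inverse \<alpha>2 \<cdot>\<^sub>m C) *\<^sub>v Im_vec p + - (transpose_mat (inverse \<alpha>2 \<cdot>\<^sub>m D) *\<^sub>v Re_vec p))"
    using dE dFt u p X unfolding w_def
    by (simp add: Re_Im_vec_add[of _ n] Re_Im_mult_mat_vec[OF dE u] Re_Im_mult_mat_vec[OF dFt p]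
        Re_Im_mat_adjoint Re_Im_complex_mat[OF X(1,2)] Re_Im_complex_mat[OF X(3,4)])
  have c: "(k \<cdot>\<^sub>m A) *\<^sub>v v \<in> carrier_vec n" "(k \<cdot>\<^sub>m B) *\<^sub>v v \<in> carrier_vec n"
    "transpose_mat (k \<cdot>\<^sub>m C) *\<^sub>v v' \<in> carrier_vec n" "transpose_mat (k \<cdot>\<^sub>m D) *\<^sub>v v' \<in> carrier_vec n"
    for k v v' by (rule carrier_vecI, use X in simp)+
  show "K1_hat n \<alpha>1 \<alpha>2 E F u p *\<^sub>v (a @\<^sub>v b @\<^sub>v c @\<^sub>v d) = Re_vec w @\<^sub>v Im_vec w"
    unfolding K1_hat_def Let_def mult Re Im
      uminus_mult_mat_vec_carrier[OF row(1)[OF iu] x(2)] uminus_mult_mat_vec_carrier[OF one(1)[OF rp] x(4)]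
      row(2)[OF ru] row(2)[OF iu] row(4)[OF ru] row(4)[OF iu] one(2)[OF rp] one(2)[OF ip] one(4)[OF rp] one(4)[OF ip]
      vec_sum_rearrange(1)[OF c] vec_sum_rearrange(2)[OF c] ..
qed

text \<open>The counterpart for the second block row. No adjoint occurs, so both pairs of blocks
  carry the usual signs of complex multiplication.\<close>

lemma K2_hat_mult_vec:
  assumes F: "F \<in> carrier_mat m n"
    and S1: "S1_mat G \<in> carrier_mat (m * m) l1" and S2: "S2_mat G \<in> carrier_mat (m * m) l2"
    and x: "c \<in> carrier_vec (m * n)" "d \<in> carrier_vec (m * n)" "s \<in> carrier_vec l1" "t \<in> carrier_vec l2"
    and X: "C \<in> carrier_mat m n" "D \<in> carrier_mat m n" "X \<in> carrier_mat m m" "Y \<in> carrier_mat m m"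
    and S: "Sigma_mat F *\<^sub>v c = vec_stack C" "Sigma_mat F *\<^sub>v d = vec_stack D"
      "S1_mat G *\<^sub>v s = vec_stack X" "S2_mat G *\<^sub>v t = vec_stack Y"
  defines "w \<equiv> complex_mat (inverse \<alpha>2) C D *\<^sub>v u + complex_mat (inverse \<alpha>3) X Y *\<^sub>v p"
  shows "K2_hat m \<alpha>2 \<alpha>3 F G u p *\<^sub>v (c @\<^sub>v d @\<^sub>v s @\<^sub>v t) = Re_vec w @\<^sub>v Im_vec w"
proof -
  note ru = Re_Im_vec_carrier(1)[OF u] and iu = Re_Im_vec_carrier(2)[OF u]
    and rp = Re_Im_vec_carrier(1)[OF p] and ip = Re_Im_vec_carrier(2)[OF p]
  note SF = Sigma_mat_carrier[OF F]
  note Fr = scaled_kronecker_row_one_mult[OF SF x(1) S(1) X(1)] scaled_kronecker_row_one_mult[OF SF x(2) S(2) X(2)]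
  note Gr = scaled_kronecker_row_one_mult[OF S1 x(3) S(3) X(3)] scaled_kronecker_row_one_mult[OF S2 x(4) S(4) X(4)]
  let ?dF = "complex_mat (inverse \<alpha>2) C D" and ?dG = "complex_mat (inverse \<alpha>3) X Y"
  have dF: "?dF \<in> carrier_mat m n" and dG: "?dG \<in> carrier_mat m m" using X by simp_all
  note carriers = Fr(1)[OF ru] uminus_carrier_mat[OF Fr(1)[OF iu]] Gr(1)[OF rp] uminus_carrier_mat[OF Gr(3)[OF ip]]
    Fr(1)[OF iu] Fr(1)[OF ru] Gr(1)[OF ip] Gr(3)[OF rp]
  note mult = two_by_four_mult_vec[OF carriers x, of "inverse \<alpha>2" "inverse \<alpha>2" "inverse \<alpha>3" "inverse \<alpha>3" "inverse \<alpha>2" "inverse \<alpha>2" "inverse \<alpha>3" "inverse \<alpha>3"]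
  have Re: "Re_vec w = (inverse \<alpha>2 \<cdot>\<^sub>m C) *\<^sub>v Re_vec u - (inverse \<alpha>2 \<cdot>\<^sub>m D) *\<^sub>v Im_vec u
      + ((inverse \<alpha>3 \<cdot>\<^sub>m X) *\<^sub>v Re_vec p - (inverse \<alpha>3 \<cdot>\<^sub>m Y) *\<^sub>v Im_vec p)"
    using dF dG u p X unfolding w_def
    by (simp add: Re_Im_vec_add[of _ m] Re_Im_mult_mat_vec[OF dF u] Re_Im_mult_mat_vec[OF dG p]
        Re_Im_complex_mat[OF X(1,2)] Re_Im_complex_mat[OF X(3,4)])
  have Im: "Im_vec w = (inverse \<alpha>2 \<cdot>\<^sub>m C) *\<^sub>v Im_vec u + (inverse \<alpha>2 \<cdot>\<^sub>m D) *\<^sub>v Re_vec u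
      + ((inverse \<alpha>3 \<cdot>\<^sub>m X) *\<^sub>v Im_vec p + (inverse \<alpha>3 \<cdot>\<^sub>m Y) *\<^sub>v Re_vec p)"
    using dF dG u p X unfolding w_def
    by (simp add: Re_Im_vec_add[of _ m] Re_Im_mult_mat_vec[OF dF u] Re_Im_mult_mat_vec[OF dG p]
        Re_Im_complex_mat[OF X(1,2)] Re_Im_complex_mat[OF X(3,4)])
  have c: "(k \<cdot>\<^sub>m C) *\<^sub>v v \<in> carrier_vec m" "(k \<cdot>\<^sub>m D) *\<^sub>v v \<in> carrier_vec m"
    "(k \<cdot>\<^sub>m X) *\<^sub>v v' \<in> carrier_vec m" "(k \<cdot>\<^sub>m Y) *\<^sub>v v' \<in> carrier_vec m"
    for k v v' by (rule carrier_vecI, use X in simp)+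
  show "K2_hat m \<alpha>2 \<alpha>3 F G u p *\<^sub>v (c @\<^sub>v d @\<^sub>v s @\<^sub>v t) = Re_vec w @\<^sub>v Im_vec w"
    unfolding K2_hat_def Let_def mult Re Im
      uminus_mult_mat_vec_carrier[OF Fr(1)[OF iu] x(2)] uminus_mult_mat_vec_carrier[OF Gr(3)[OF ip] x(4)]
      Fr(2)[OF ru] Fr(2)[OF iu] Fr(4)[OF ru] Fr(4)[OF iu] Gr(2)[OF rp] Gr(2)[OF ip] Gr(4)[OF rp] Gr(4)[OF ip]
      vec_sum_rearrange(3)[OF c] vec_sum_rearrange(4)[OF c] ..
qed

end

section \<open>Coordinates of a perturbation\<close>

lemma carrier_vec_append_cases:
  assumes "x \<in> carrier_vec (k + l)"
  obtains y z where "x = y @\<^sub>v z" "y \<in> carrier_vec k" "z \<in> carrier_vec l"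
  using vec_first_last_append[OF assms] that[of "vec_first x k" "vec_last x l"] by simp

lemma isometric_param_decode:
  assumes "isometric_param S C" "S \<in> carrier_mat r l" "s \<in> carrier_vec l"
  obtains Z where "Z \<in> C" "S *\<^sub>v s = vec_stack Z" "frob_norm Z \<le> norm2 s"
  using assms by (auto simp: isometric_param_def)

lemma isometric_param_encode:
  assumes "isometric_param S C" "S \<in> carrier_mat r l" "Z \<in> C"
  obtains s where "s \<in> carrier_vec l" "S *\<^sub>v s = vec_stack Z" "norm2 s = frob_norm Z"
  using assms by (auto simp: isometric_param_def)

definition real_stack :: "complex vec \<Rightarrow> complex vec \<Rightarrow> real vec" where
  "real_stack w z = Re_vec w @\<^sub>v Im_vec w @\<^sub>v Re_vec z @\<^sub>v Im_vec z"

lemma real_stack_carrier: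
  "w \<in> carrier_vec n \<Longrightarrow> z \<in> carrier_vec m \<Longrightarrow> real_stack w z \<in> carrier_vec (2 * n + 2 * m)"
  by (intro carrier_vecI) (simp add: real_stack_def)

lemma Re_Im_vec_eq_iff:
  assumes "x \<in> carrier_vec n" "y \<in> carrier_vec n"
  shows "Re_vec x = Re_vec y \<and> Im_vec x = Im_vec y \<longleftrightarrow> x = y"
proof
  assume eq: "Re_vec x = Re_vec y \<and> Im_vec x = Im_vec y"
  show "x = y"
  proof (rule eq_vecI)
    fix i assume i: "i < dim_vec y"
    have "Re_vec x $ i = Re_vec y $ i" "Im_vec x $ i = Im_vec y $ i" using eq by simp_all
    thus "x $ i = y $ i" using i assms by (simp add: complex_eq_iff)
  qed (use assms in simp)
qed simp

lemma real_stack_eq_iff: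
  assumes w: "w \<in> carrier_vec n" "w' \<in> carrier_vec n" and z: "z \<in> carrier_vec m" "z' \<in> carrier_vec m"
  shows "real_stack w z = real_stack w' z' \<longleftrightarrow> w = w' \<and> z = z'"
  unfolding real_stack_def
    append_vec_eq[OF Re_Im_vec_carrier(1)[OF w(1)] Re_Im_vec_carrier(1)[OF w(2)]]
    append_vec_eq[OF Re_Im_vec_carrier(2)[OF w(1)] Re_Im_vec_carrier(2)[OF w(2)]]
    append_vec_eq[OF Re_Im_vec_carrier(1)[OF z(1)] Re_Im_vec_carrier(1)[OF z(2)]]
  using Re_Im_vec_eq_iff[OF w] Re_Im_vec_eq_iff[OF z] by blast

lemma ex_real_stack:
  assumes "b \<in> carrier_vec (2 * n + 2 * m)"
  obtains w z where "w \<in> carrier_vec n" "z \<in> carrier_vec m" "real_stack w z = b"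
proof -
  obtain b1 b2 b3 b4 where b: "b = (b1 @\<^sub>v b2) @\<^sub>v (b3 @\<^sub>v b4)" "b1 \<in> carrier_vec n" "b2 \<in> carrier_vec n"
    "b3 \<in> carrier_vec m" "b4 \<in> carrier_vec m"
    using assms unfolding mult_2 by (metis carrier_vec_append_cases)
  have "real_stack (complex_vec 1 b1 b2) (complex_vec 1 b3 b4) = b"
    unfolding real_stack_def Re_Im_complex_vec[OF b(2,3)] Re_Im_complex_vec[OF b(4,5)] one_smult_vec b(1)
      append_vec_assoc ..
  thus thesis
    using b(2-5) by (intro that[of "complex_vec 1 b1 b2" "complex_vec 1 b3 b4"]) simp_all
qed

lemma zero_mat_mult_vec: "v \<in> carrier_vec c \<Longrightarrow> 0\<^sub>m r c *\<^sub>v v = (0\<^sub>v r :: 'a::semiring_0 vec)"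
  by (intro eq_vecI) simp_all

lemma uminus_scaled_one_mult_vec:
  "v \<in> carrier_vec k \<Longrightarrow> (- (c \<cdot>\<^sub>m 1\<^sub>m k)) *\<^sub>v v = - (c \<cdot>\<^sub>v (v :: 'a::comm_ring_1 vec))"
  using smult_mat_mult_vec[OF one_carrier_mat, of v k c] by simp

lemma Re_Im_minus_complex_vec:
  assumes "w \<in> carrier_vec n" "x \<in> carrier_vec n" "y \<in> carrier_vec n"
  shows "(Re_vec w @\<^sub>v Im_vec w) + - (k \<cdot>\<^sub>v (x @\<^sub>v y))
      = Re_vec (w - complex_vec k x y) @\<^sub>v Im_vec (w - complex_vec k x y)"
  using assms by (intro eq_vecI) (auto simp: complex_vec_def)

text \<open>The left columns belong to \<open>E\<close>, \<open>F\<close> and \<open>G\<close> in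
  this order. The zero paddings cover \<open>G\<close> above and \<open>E\<close> below, so one set
  of \<open>F\<close> coordinates feeds both rows and forces the same perturbation of
  \<open>F\<close> in both equations.\<close>

definition coefficient_mat where
  "coefficient_mat n m \<alpha>1 \<alpha>2 \<alpha>3 \<beta>1 \<beta>2 E F G u p = four_block_mat
     (K1_hat n \<alpha>1 \<alpha>2 E F u p @\<^sub>c 0\<^sub>m (2 * n) (m\<^sup>2))
     (- (inverse \<beta>1 \<cdot>\<^sub>m 1\<^sub>m (2 * n)) @\<^sub>c 0\<^sub>m (2 * n) (2 * m))
     (0\<^sub>m (2 * m) (2 * n\<^sup>2) @\<^sub>c K2_hat m \<alpha>2 \<alpha>3 F G u p)
     (0\<^sub>m (2 * m) (2 * n) @\<^sub>c - (inverse \<beta>2 \<cdot>\<^sub>m 1\<^sub>m (2 * m)))"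

context
  fixes n m :: nat and E F G :: "complex mat" and u p :: "complex vec" and \<alpha>1 \<alpha>2 \<alpha>3 \<beta>1 \<beta>2 :: real
  assumes E: "E \<in> carrier_mat n n" and F: "F \<in> carrier_mat m n" and G: "G \<in> carrier_mat m m"
    and herm: "hermitian_mat G" and u: "u \<in> carrier_vec n" and p: "p \<in> carrier_vec m"
    and pos: "\<alpha>1 > 0" "\<alpha>2 > 0" "\<alpha>3 > 0" "\<beta>1 > 0" "\<beta>2 > 0"
begin

abbreviation (input) "coeff_M \<equiv> coefficient_mat n m \<alpha>1 \<alpha>2 \<alpha>3 \<beta>1 \<beta>2 E F G u p"

abbreviation (input) "dim_S \<equiv> m * (m + 1) div 2"
abbreviation (input) "dim_SK \<equiv> m * (m - 1) div 2"
abbreviation (input) "num_cols \<equiv> n * n + (n * n + (m * n + (m * n + (dim_S + dim_SK)))) + (2 * n + 2 * m)"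

definition sparse_perturbation where
  "sparse_perturbation dE dF dG dq dr \<longleftrightarrow>
     dE \<in> carrier_mat n n \<and> dF \<in> carrier_mat m n \<and> dG \<in> carrier_mat m m \<and> hermitian_mat dG \<and>
     dq \<in> carrier_vec n \<and> dr \<in> carrier_vec m \<and> sparse_in E dE \<and> sparse_in F dF \<and> sparse_in G dG"

text \<open>For fixed \<open>u\<close> and \<open>p\<close> the perturbed equations are affine in
  the perturbation; this is their linear part, to be matched with the residuals.\<close>

definition perturbation_effect where
  "perturbation_effect dE dF dG dq dr =
     real_stack (dE *\<^sub>v u + mat_adjoint dF *\<^sub>v p - dq) (dF *\<^sub>v u + dG *\<^sub>v p - dr)"

text \<open>The real and imaginary coordinates of a Hermitian matrix together number
  \<open>m\<^sup>2\<close>, the width of the padding beside \<open>K1_hat\<close>.\<close>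

lemma dim_S_plus_dim_SK: "dim_S + dim_SK = m\<^sup>2"
proof (cases m)
  case (Suc k)
  \<comment> \<open>A product of consecutive numbers is even, which removes both occurrences of
    \<open>div 2\<close>.\<close>
  obtain c where c: "Suc k * k = 2 * c" by (metis even_Suc even_mult_iff dvdE)
  have "m * (m + 1) = 2 * (c + m)" and "m * (m - 1) = 2 * c" and "m\<^sup>2 = c + m + c"
    using c Suc by (simp_all add: power2_eq_square)
  note eqs = this
  show ?thesis unfolding eqs by simp
qed simp

lemma block_carriers:
  "K1_hat n \<alpha>1 \<alpha>2 E F u p @\<^sub>c 0\<^sub>m (2 * n) (m\<^sup>2)
     \<in> carrier_mat (2 * n) (n * n + (n * n + (m * n + (m * n + (dim_S + dim_SK)))))"
  "- (inverse \<beta>1 \<cdot>\<^sub>m 1\<^sub>m (2 * n)) @\<^sub>c 0\<^sub>m (2 * n) (2 * m) \<in> carrier_mat (2 * n) (2 * n + 2 * m)"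
  "0\<^sub>m (2 * m) (2 * n\<^sup>2) @\<^sub>c K2_hat m \<alpha>2 \<alpha>3 F G u p
     \<in> carrier_mat (2 * m) (n * n + (n * n + (m * n + (m * n + (dim_S + dim_SK)))))"
  "0\<^sub>m (2 * m) (2 * n) @\<^sub>c - (inverse \<beta>2 \<cdot>\<^sub>m 1\<^sub>m (2 * m)) \<in> carrier_mat (2 * m) (2 * n + 2 * m)"
proof -
  have "K1_hat n \<alpha>1 \<alpha>2 E F u p @\<^sub>c 0\<^sub>m (2 * n) (m\<^sup>2)
     \<in> carrier_mat (2 * n) (n * n + (n * n + (m * n + m * n)) + m\<^sup>2)"
    using K1_hat_carrier[OF u p E F] by auto
  thus "K1_hat n \<alpha>1 \<alpha>2 E F u p @\<^sub>c 0\<^sub>m (2 * n) (m\<^sup>2)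
     \<in> carrier_mat (2 * n) (n * n + (n * n + (m * n + (m * n + (dim_S + dim_SK)))))"
    by (simp only: dim_S_plus_dim_SK add.assoc)
  have "0\<^sub>m (2 * m) (2 * n\<^sup>2) @\<^sub>c K2_hat m \<alpha>2 \<alpha>3 F G u p
     \<in> carrier_mat (2 * m) (2 * n\<^sup>2 + (m * n + (m * n + (dim_S + dim_SK))))"
    by (rule append_cols_carrier[OF zero_carrier_mat
        K2_hat_carrier[OF u p F isometric_param_S1_mat(1)[OF G herm] isometric_param_S2_mat(1)[OF G herm]]])
  thus "0\<^sub>m (2 * m) (2 * n\<^sup>2) @\<^sub>c K2_hat m \<alpha>2 \<alpha>3 F G u p
     \<in> carrier_mat (2 * m) (n * n + (n * n + (m * n + (m * n + (dim_S + dim_SK)))))"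
    by (simp only: power2_eq_square mult_2 add.assoc)
qed auto

lemma coefficient_mat_carrier: "coeff_M \<in> carrier_mat (2 * n + 2 * m) num_cols"
  unfolding coefficient_mat_def by (rule four_block_carrier_mat[OF block_carriers(1,4)])

text \<open>The coordinates enter only through the matrices they parametrize, so the same
  computation serves decoding an arbitrary vector and encoding a given perturbation.\<close>

lemma coefficient_mat_mult_vec:
  assumes x: "a \<in> carrier_vec (n * n)" "b \<in> carrier_vec (n * n)" "c \<in> carrier_vec (m * n)" "d \<in> carrier_vec (m * n)"
      "s \<in> carrier_vec dim_S" "t \<in> carrier_vec dim_SK"
      "e1 \<in> carrier_vec n" "e2 \<in> carrier_vec n" "f1 \<in> carrier_vec m" "f2 \<in> carrier_vec m"
    and X: "A \<in> carrier_mat n n" "B \<in> carrier_mat n n" "C \<in> carrier_mat m n" "D \<in> carrier_mat m n"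
      "X \<in> carrier_mat m m" "Y \<in> carrier_mat m m"
    and S: "Sigma_mat E *\<^sub>v a = vec_stack A" "Sigma_mat E *\<^sub>v b = vec_stack B"
      "Sigma_mat F *\<^sub>v c = vec_stack C" "Sigma_mat F *\<^sub>v d = vec_stack D"
      "S1_mat G *\<^sub>v s = vec_stack X" "S2_mat G *\<^sub>v t = vec_stack Y"
  shows "coeff_M *\<^sub>v ((a @\<^sub>v b @\<^sub>v c @\<^sub>v d @\<^sub>v s @\<^sub>v t) @\<^sub>v (e1 @\<^sub>v e2 @\<^sub>v f1 @\<^sub>v f2)) =
    perturbation_effect (complex_mat (inverse \<alpha>1) A B) (complex_mat (inverse \<alpha>2) C D)
      (complex_mat (inverse \<alpha>3) X Y) (complex_vec (inverse \<beta>1) e1 e2) (complex_vec (inverse \<beta>2) f1 f2)"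
proof -
  note S1 = isometric_param_S1_mat(1)[OF G herm] and S2 = isometric_param_S2_mat(1)[OF G herm]
  let ?dE = "complex_mat (inverse \<alpha>1) A B" and ?dF = "complex_mat (inverse \<alpha>2) C D"
    and ?dG = "complex_mat (inverse \<alpha>3) X Y"
    and ?dq = "complex_vec (inverse \<beta>1) e1 e2" and ?dr = "complex_vec (inverse \<beta>2) f1 f2"
  define w where "w = ?dE *\<^sub>v u + mat_adjoint ?dF *\<^sub>v p"
  define z where "z = ?dF *\<^sub>v u + ?dG *\<^sub>v p"
  have "mat_adjoint ?dF \<in> carrier_mat n m" using X by (intro mat_adjoint_carrier) simp
  hence w: "w \<in> carrier_vec n" unfolding w_def using X u p
    by (intro add_carrier_vec mult_mat_vec_carrier) simp_all
  have z: "z \<in> carrier_vec m" unfolding z_def using X u p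
    by (intro add_carrier_vec mult_mat_vec_carrier) simp_all
  \<comment> \<open>The same vector is cut after the \<open>F\<close> coordinates for the upper row
    and after the \<open>E\<close> coordinates for the lower row, where the respective zero padding
    starts or ends.\<close>
  have abcd: "a @\<^sub>v b @\<^sub>v c @\<^sub>v d \<in> carrier_vec (n * n + (n * n + (m * n + m * n)))"
    and st: "s @\<^sub>v t \<in> carrier_vec (m\<^sup>2)"
    and ab: "a @\<^sub>v b \<in> carrier_vec (2 * n\<^sup>2)"
    and cdst: "c @\<^sub>v d @\<^sub>v s @\<^sub>v t \<in> carrier_vec (m * n + (m * n + (dim_S + dim_SK)))"
    and all: "a @\<^sub>v b @\<^sub>v c @\<^sub>v d @\<^sub>v s @\<^sub>v t \<in> carrier_vec (n * n + (n * n + (m * n + (m * n + (dim_S + dim_SK)))))"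
    and ee: "e1 @\<^sub>v e2 \<in> carrier_vec (2 * n)" and ff: "f1 @\<^sub>v f2 \<in> carrier_vec (2 * m)"
    and eeff: "e1 @\<^sub>v e2 @\<^sub>v f1 @\<^sub>v f2 \<in> carrier_vec (2 * n + 2 * m)"
    using x dim_S_plus_dim_SK by (intro carrier_vecI; simp add: power2_eq_square)+
  have Re_w: "Re_vec w @\<^sub>v Im_vec w \<in> carrier_vec (2 * n)" and Re_z: "Re_vec z @\<^sub>v Im_vec z \<in> carrier_vec (2 * m)"
    using w z by (intro carrier_vecI; simp)+
  have K1: "(K1_hat n \<alpha>1 \<alpha>2 E F u p @\<^sub>c 0\<^sub>m (2 * n) (m\<^sup>2)) *\<^sub>v (a @\<^sub>v b @\<^sub>v c @\<^sub>v d @\<^sub>v s @\<^sub>v t)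
      = Re_vec w @\<^sub>v Im_vec w"
    using append_cols_mult_vec[OF K1_hat_carrier[OF u p E F] zero_carrier_mat abcd st]
      K1_hat_mult_vec[OF u p E F x(1-4) X(1-4) S(1-4)] zero_mat_mult_vec[OF st]
    by (simp add: append_vec_assoc right_zero_vec[OF Re_w] flip: w_def)
  have K2: "(0\<^sub>m (2 * m) (2 * n\<^sup>2) @\<^sub>c K2_hat m \<alpha>2 \<alpha>3 F G u p) *\<^sub>v (a @\<^sub>v b @\<^sub>v c @\<^sub>v d @\<^sub>v s @\<^sub>v t)
      = Re_vec z @\<^sub>v Im_vec z"
    using append_cols_mult_vec[OF zero_carrier_mat K2_hat_carrier[OF u p F S1 S2] ab cdst]
      K2_hat_mult_vec[OF u p F S1 S2 x(3-6) X(3-6) S(3-6)] zero_mat_mult_vec[OF ab]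
    by (simp add: append_vec_assoc left_zero_vec[OF Re_z] flip: z_def)
  have I1: "(- (inverse \<beta>1 \<cdot>\<^sub>m 1\<^sub>m (2 * n)) @\<^sub>c 0\<^sub>m (2 * n) (2 * m)) *\<^sub>v (e1 @\<^sub>v e2 @\<^sub>v f1 @\<^sub>v f2)
      = - (inverse \<beta>1 \<cdot>\<^sub>v (e1 @\<^sub>v e2))"
    using append_cols_mult_vec[of "- (inverse \<beta>1 \<cdot>\<^sub>m 1\<^sub>m (2 * n))" "2 * n" "2 * n", OF _ zero_carrier_mat ee ff]
      uminus_scaled_one_mult_vec[OF ee] zero_mat_mult_vec[OF ff] ee
    by (simp add: append_vec_assoc)
  have I2: "(0\<^sub>m (2 * m) (2 * n) @\<^sub>c - (inverse \<beta>2 \<cdot>\<^sub>m 1\<^sub>m (2 * m))) *\<^sub>v (e1 @\<^sub>v e2 @\<^sub>v f1 @\<^sub>v f2)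
      = - (inverse \<beta>2 \<cdot>\<^sub>v (f1 @\<^sub>v f2))"
    using append_cols_mult_vec[of _ "2 * m" "2 * n" "- (inverse \<beta>2 \<cdot>\<^sub>m 1\<^sub>m (2 * m))", OF zero_carrier_mat _ ee ff]
      uminus_scaled_one_mult_vec[OF ff] zero_mat_mult_vec[OF ee] ff
    by (simp add: append_vec_assoc)
  show ?thesis
    unfolding coefficient_mat_def four_block_mat_mult_vec[OF block_carriers all eeff] K1 K2 I1 I2
      Re_Im_minus_complex_vec[OF w x(7,8)] Re_Im_minus_complex_vec[OF z x(9,10)]
    by (simp add: perturbation_effect_def real_stack_def append_vec_assoc w_def z_def)
qed

lemma zeta_complex:
  assumes X: "A \<in> carrier_mat n n" "B \<in> carrier_mat n n" "C \<in> carrier_mat m n" "D \<in> carrier_mat m n"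
      "X \<in> carrier_mat m m" "Y \<in> carrier_mat m m"
    and e: "e1 \<in> carrier_vec n" "e2 \<in> carrier_vec n" "f1 \<in> carrier_vec m" "f2 \<in> carrier_vec m"
  shows "zeta \<alpha>1 \<alpha>2 \<alpha>3 \<beta>1 \<beta>2 (complex_mat (inverse \<alpha>1) A B) (complex_mat (inverse \<alpha>2) C D)
      (complex_mat (inverse \<alpha>3) X Y) (complex_vec (inverse \<beta>1) e1 e2) (complex_vec (inverse \<beta>2) f1 f2)
    = sqrt ((frob_norm A)\<^sup>2 + (frob_norm B)\<^sup>2 + (frob_norm C)\<^sup>2 + (frob_norm D)\<^sup>2 + (frob_norm X)\<^sup>2 + (frob_norm Y)\<^sup>2
        + (norm2 e1)\<^sup>2 + (norm2 e2)\<^sup>2 + (norm2 f1)\<^sup>2 + (norm2 f2)\<^sup>2)"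
proof -
  have cancel: "k\<^sup>2 * ((inverse k)\<^sup>2 * y) = y" if "k > 0" for k y :: real
    using that by (simp add: field_simps)
  show ?thesis
    unfolding zeta_def frob_norm_complex_mat[OF X(1,2)] frob_norm_complex_mat[OF X(3,4)] frob_norm_complex_mat[OF X(5,6)]
      norm2_complex_vec[OF e(1,2)] norm2_complex_vec[OF e(3,4)] cancel[OF pos(1)] cancel[OF pos(2)] cancel[OF pos(3)]
      cancel[OF pos(4)] cancel[OF pos(5)] add.assoc ..
qed

text \<open>Applied to the least-norm solution, this produces an admissible perturbation whose value
  is no larger than that norm.\<close>

lemma decode_perturbation:
  assumes x: "x \<in> carrier_vec num_cols"
  obtains dE dF dG dq dr where "sparse_perturbation dE dF dG dq dr"
    "coeff_M *\<^sub>v x = perturbation_effect dE dF dG dq dr" "zeta \<alpha>1 \<alpha>2 \<alpha>3 \<beta>1 \<beta>2 dE dF dG dq dr \<le> norm2 x"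
proof -
  note cases = carrier_vec_append_cases
  obtain y z where x_eq: "x = y @\<^sub>v z" and y: "y \<in> carrier_vec (n * n + (n * n + (m * n + (m * n + (dim_S + dim_SK)))))"
    and z: "z \<in> carrier_vec (2 * n + 2 * m)" using x by (rule cases)
  obtain a y1 where y_eq: "y = a @\<^sub>v y1" and a: "a \<in> carrier_vec (n * n)"
    and y1: "y1 \<in> carrier_vec (n * n + (m * n + (m * n + (dim_S + dim_SK))))" using y by (rule cases)
  obtain b y2 where y1_eq: "y1 = b @\<^sub>v y2" and b: "b \<in> carrier_vec (n * n)"
    and y2: "y2 \<in> carrier_vec (m * n + (m * n + (dim_S + dim_SK)))" using y1 by (rule cases)
  obtain c y3 where y2_eq: "y2 = c @\<^sub>v y3" and c: "c \<in> carrier_vec (m * n)"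
    and y3: "y3 \<in> carrier_vec (m * n + (dim_S + dim_SK))" using y2 by (rule cases)
  obtain d y4 where y3_eq: "y3 = d @\<^sub>v y4" and d: "d \<in> carrier_vec (m * n)"
    and y4: "y4 \<in> carrier_vec (dim_S + dim_SK)" using y3 by (rule cases)
  obtain s t where y4_eq: "y4 = s @\<^sub>v t" and st: "s \<in> carrier_vec dim_S" "t \<in> carrier_vec dim_SK"
    using y4 by (rule cases)
  obtain e f where z_eq: "z = e @\<^sub>v f" and e: "e \<in> carrier_vec (n + n)" and f: "f \<in> carrier_vec (m + m)"
    using z unfolding mult_2 by (rule cases)
  obtain e1 e2 where e_eq: "e = e1 @\<^sub>v e2" and ee: "e1 \<in> carrier_vec n" "e2 \<in> carrier_vec n" using e by (rule cases)
  obtain f1 f2 where f_eq: "f = f1 @\<^sub>v f2" and ff: "f1 \<in> carrier_vec m" "f2 \<in> carrier_vec m" using f by (rule cases)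
  have x_split: "x = (a @\<^sub>v b @\<^sub>v c @\<^sub>v d @\<^sub>v s @\<^sub>v t) @\<^sub>v (e1 @\<^sub>v e2 @\<^sub>v f1 @\<^sub>v f2)"
    unfolding x_eq y_eq y1_eq y2_eq y3_eq y4_eq z_eq e_eq f_eq by (simp only: append_vec_assoc)
  note dec_E = isometric_param_decode[OF isometric_param_Sigma_mat[OF E] Sigma_mat_carrier[OF E]]
    and dec_F = isometric_param_decode[OF isometric_param_Sigma_mat[OF F] Sigma_mat_carrier[OF F]]
  obtain A where A: "A \<in> carrier_mat n n" "sparse_in E A" "Sigma_mat E *\<^sub>v a = vec_stack A" "frob_norm A \<le> norm2 a"
    using dec_E[OF a] by auto
  obtain B where B: "B \<in> carrier_mat n n" "sparse_in E B" "Sigma_mat E *\<^sub>v b = vec_stack B" "frob_norm B \<le> norm2 b"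
    using dec_E[OF b] by auto
  obtain C where C: "C \<in> carrier_mat m n" "sparse_in F C" "Sigma_mat F *\<^sub>v c = vec_stack C" "frob_norm C \<le> norm2 c"
    using dec_F[OF c] by auto
  obtain D where D: "D \<in> carrier_mat m n" "sparse_in F D" "Sigma_mat F *\<^sub>v d = vec_stack D" "frob_norm D \<le> norm2 d"
    using dec_F[OF d] by auto
  obtain X where X: "X \<in> carrier_mat m m" "symmetric_mat X" "sparse_in G X" "S1_mat G *\<^sub>v s = vec_stack X"
    "frob_norm X \<le> norm2 s"
    using isometric_param_decode[OF isometric_param_S1_mat(2,1)[OF G herm] st(1)] by auto
  obtain Y where Y: "Y \<in> carrier_mat m m" "skew_mat Y" "sparse_in G Y" "S2_mat G *\<^sub>v t = vec_stack Y"
    "frob_norm Y \<le> norm2 t"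
    using isometric_param_decode[OF isometric_param_S2_mat(2,1)[OF G herm] st(2)] by auto
  let ?dE = "complex_mat (inverse \<alpha>1) A B" and ?dF = "complex_mat (inverse \<alpha>2) C D"
    and ?dG = "complex_mat (inverse \<alpha>3) X Y"
    and ?dq = "complex_vec (inverse \<beta>1) e1 e2" and ?dr = "complex_vec (inverse \<beta>2) f1 f2"
  show thesis
  proof
    show "sparse_perturbation ?dE ?dF ?dG ?dq ?dr"
      unfolding sparse_perturbation_def complex_mat_carrier complex_vec_carrier
      using A(1) C(1) X(1) ee(1) ff(1) hermitian_complex_mat[OF X(1) Y(1) X(2) Y(2)]
        sparse_in_complex_mat[OF A(1) B(1) A(2) B(2)] sparse_in_complex_mat[OF C(1) D(1) C(2) D(2)]
        sparse_in_complex_mat[OF X(1) Y(1) X(3) Y(3)] by blast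
    show "coeff_M *\<^sub>v x = perturbation_effect ?dE ?dF ?dG ?dq ?dr"
      unfolding x_split
      by (rule coefficient_mat_mult_vec[OF a b c d st ee ff A(1) B(1) C(1) D(1) X(1) Y(1) A(3) B(3) C(3) D(3) X(4) Y(4)])
    have "(zeta \<alpha>1 \<alpha>2 \<alpha>3 \<beta>1 \<beta>2 ?dE ?dF ?dG ?dq ?dr)\<^sup>2 \<le> (norm2 x)\<^sup>2"
      unfolding zeta_complex[OF A(1) B(1) C(1) D(1) X(1) Y(1) ee ff] x_split norm2_append
      using A(4) B(4) C(4) D(4) X(5) Y(5) by (simp add: add_mono power_mono)
    thus "zeta \<alpha>1 \<alpha>2 \<alpha>3 \<beta>1 \<beta>2 ?dE ?dF ?dG ?dq ?dr \<le> norm2 x"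
      by (rule power2_le_imp_le) simp
  qed
qed

text \<open>Multiplying real and imaginary parts by the weights cancels the inverse weights in the
  coefficient matrix, and matrices obeying the pattern have coordinates of equal norm. The lower
  bound on all values and the surjectivity of the coefficient matrix both rest on this.\<close>

lemma encode_perturbation:
  assumes pert: "sparse_perturbation dE dF dG dq dr"
  obtains x where "x \<in> carrier_vec num_cols" "coeff_M *\<^sub>v x = perturbation_effect dE dF dG dq dr"
    "norm2 x = zeta \<alpha>1 \<alpha>2 \<alpha>3 \<beta>1 \<beta>2 dE dF dG dq dr"
proof -
  define A where "A = \<alpha>1 \<cdot>\<^sub>m Re_mat dE"
  define B where "B = \<alpha>1 \<cdot>\<^sub>m Im_mat dE"
  define C where "C = \<alpha>2 \<cdot>\<^sub>m Re_mat dF"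
  define D where "D = \<alpha>2 \<cdot>\<^sub>m Im_mat dF"
  define X where "X = \<alpha>3 \<cdot>\<^sub>m Re_mat dG"
  define Y where "Y = \<alpha>3 \<cdot>\<^sub>m Im_mat dG"
  define e1 where "e1 = \<beta>1 \<cdot>\<^sub>v Re_vec dq"
  define e2 where "e2 = \<beta>1 \<cdot>\<^sub>v Im_vec dq"
  define f1 where "f1 = \<beta>2 \<cdot>\<^sub>v Re_vec dr"
  define f2 where "f2 = \<beta>2 \<cdot>\<^sub>v Im_vec dr"
  note defs = A_def B_def C_def D_def X_def Y_def e1_def e2_def f1_def f2_def
  have eqs: "complex_mat (inverse \<alpha>1) A B = dE" "complex_mat (inverse \<alpha>2) C D = dF" "complex_mat (inverse \<alpha>3) X Y = dG"
    "complex_vec (inverse \<beta>1) e1 e2 = dq" "complex_vec (inverse \<beta>2) f1 f2 = dr"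
    unfolding defs by (rule complex_mat_Re_Im complex_vec_Re_Im, use pos in simp)+
  have carriers: "A \<in> carrier_mat n n" "B \<in> carrier_mat n n" "C \<in> carrier_mat m n" "D \<in> carrier_mat m n"
    "X \<in> carrier_mat m m" "Y \<in> carrier_mat m m"
    "e1 \<in> carrier_vec n" "e2 \<in> carrier_vec n" "f1 \<in> carrier_vec m" "f2 \<in> carrier_vec m"
    using pert unfolding sparse_perturbation_def defs by auto
  have sparse: "sparse_in E A" "sparse_in E B" "sparse_in F C" "sparse_in F D" "sparse_in G X" "sparse_in G Y"
    using pert unfolding sparse_perturbation_def defs by (blast intro: sparse_in_smult_Re_Im)+
  have sym: "symmetric_mat X" "skew_mat Y"
    using pert unfolding sparse_perturbation_def defs by (blast intro: symmetry_smult_Re_Im_hermitian)+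
  note enc_E = isometric_param_encode[OF isometric_param_Sigma_mat[OF E] Sigma_mat_carrier[OF E]]
    and enc_F = isometric_param_encode[OF isometric_param_Sigma_mat[OF F] Sigma_mat_carrier[OF F]]
  obtain a where a: "a \<in> carrier_vec (n * n)" "Sigma_mat E *\<^sub>v a = vec_stack A" "norm2 a = frob_norm A"
    using enc_E[of A] carriers sparse by blast
  obtain b where b: "b \<in> carrier_vec (n * n)" "Sigma_mat E *\<^sub>v b = vec_stack B" "norm2 b = frob_norm B"
    using enc_E[of B] carriers sparse by blast
  obtain c where c: "c \<in> carrier_vec (m * n)" "Sigma_mat F *\<^sub>v c = vec_stack C" "norm2 c = frob_norm C"
    using enc_F[of C] carriers sparse by blast
  obtain d where d: "d \<in> carrier_vec (m * n)" "Sigma_mat F *\<^sub>v d = vec_stack D" "norm2 d = frob_norm D"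
    using enc_F[of D] carriers sparse by blast
  obtain s where s: "s \<in> carrier_vec dim_S" "S1_mat G *\<^sub>v s = vec_stack X" "norm2 s = frob_norm X"
    using isometric_param_encode[OF isometric_param_S1_mat(2,1)[OF G herm], of X] carriers sparse sym by blast
  obtain t where t: "t \<in> carrier_vec dim_SK" "S2_mat G *\<^sub>v t = vec_stack Y" "norm2 t = frob_norm Y"
    using isometric_param_encode[OF isometric_param_S2_mat(2,1)[OF G herm], of Y] carriers sparse sym by blast
  let ?x = "(a @\<^sub>v b @\<^sub>v c @\<^sub>v d @\<^sub>v s @\<^sub>v t) @\<^sub>v (e1 @\<^sub>v e2 @\<^sub>v f1 @\<^sub>v f2)"
  show thesis
  proof
    show "?x \<in> carrier_vec num_cols"
      using a(1) b(1) c(1) d(1) s(1) t(1) carriers(7-10) by (intro carrier_vecI) simp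
    show "coeff_M *\<^sub>v ?x = perturbation_effect dE dF dG dq dr"
      using coefficient_mat_mult_vec[OF a(1) b(1) c(1) d(1) s(1) t(1) carriers(7-10) carriers(1-6)
          a(2) b(2) c(2) d(2) s(2) t(2)]
      unfolding eqs .
    have "zeta \<alpha>1 \<alpha>2 \<alpha>3 \<beta>1 \<beta>2 dE dF dG dq dr = sqrt ((norm2 ?x)\<^sup>2)"
      using zeta_complex[OF carriers] unfolding eqs
      by (simp only: norm2_append a(3) b(3) c(3) d(3) s(3) t(3) add.assoc)
    thus "norm2 ?x = zeta \<alpha>1 \<alpha>2 \<alpha>3 \<beta>1 \<beta>2 dE dF dG dq dr" by simp
  qed
qed

text \<open>Perturbing the right-hand side alone reaches every target. With zero matrices the effect
  is the negative of that perturbation, whence the witnesses \<open>- w\<close> and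
  \<open>- z\<close>.\<close>

lemma coefficient_mat_surj:
  assumes "b \<in> carrier_vec (2 * n + 2 * m)"
  shows "\<exists>x\<in>carrier_vec num_cols. coeff_M *\<^sub>v x = b"
proof -
  obtain w z where wz: "w \<in> carrier_vec n" "z \<in> carrier_vec m" "real_stack w z = b"
    using ex_real_stack[OF assms] .
  have "sparse_perturbation (0\<^sub>m n n) (0\<^sub>m m n) (0\<^sub>m m m) (- w) (- z)"
    using wz by (simp add: sparse_perturbation_def sparse_in_def hermitian_mat_iff[of _ m])
  then obtain x where x: "x \<in> carrier_vec num_cols"
    "coeff_M *\<^sub>v x = perturbation_effect (0\<^sub>m n n) (0\<^sub>m m n) (0\<^sub>m m m) (- w) (- z)"
    by (rule encode_perturbation)
  have "mat_adjoint (0\<^sub>m m n) = (0\<^sub>m n m :: complex mat)" by (intro eq_matI) simp_all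
  hence "coeff_M *\<^sub>v x = b"
    using x(2) wz u p by (simp add: perturbation_effect_def zero_mat_mult_vec)
  with x(1) show ?thesis by blast
qed

section \<open>The backward error as a least norm\<close>

text \<open>Expanding the perturbed product by distributivity and moving the unperturbed terms to
  the other side turns the two complex block equations into one real equation with the
  residuals.\<close>

lemma sparse_perturbation_mem_G2_set_iff:
  assumes pert: "sparse_perturbation dE dF dG dq dr" and q: "q \<in> carrier_vec n" and r: "r \<in> carrier_vec m"
  shows "(dE, dF, dG, dq, dr) \<in> G2_set n m E F G q r u p \<longleftrightarrow>
    perturbation_effect dE dF dG dq dr
      = real_stack (q - E *\<^sub>v u - mat_adjoint F *\<^sub>v p) (r - F *\<^sub>v u - G *\<^sub>v p)"
proof -
  have d: "dE \<in> carrier_mat n n" "dF \<in> carrier_mat m n" "dG \<in> carrier_mat m m" "hermitian_mat dG"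
    "dq \<in> carrier_vec n" "dr \<in> carrier_vec m"
    using pert by (auto simp: sparse_perturbation_def)
  note Ft = mat_adjoint_carrier[OF F] and dFt = mat_adjoint_carrier[OF d(2)]
  have adj: "mat_adjoint (F + dF) = mat_adjoint F + mat_adjoint dF"
    using F d(2) by (intro eq_matI) simp_all
  have rearrange: "a + b + (c + e) = f + g \<longleftrightarrow> b + e - g = f - a - c"
    if "a \<in> carrier_vec k" "b \<in> carrier_vec k" "c \<in> carrier_vec k" "e \<in> carrier_vec k" "f \<in> carrier_vec k" "g \<in> carrier_vec k"
    for a b c e f g :: "complex vec" and k
    using that by (auto simp: vec_eq_iff complex_eq_iff)
  have carriers: "E *\<^sub>v u \<in> carrier_vec n" "dE *\<^sub>v u \<in> carrier_vec n" "mat_adjoint F *\<^sub>v p \<in> carrier_vec n"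
    "mat_adjoint dF *\<^sub>v p \<in> carrier_vec n" "F *\<^sub>v u \<in> carrier_vec m" "dF *\<^sub>v u \<in> carrier_vec m"
    "G *\<^sub>v p \<in> carrier_vec m" "dG *\<^sub>v p \<in> carrier_vec m"
    using E F G d u p Ft dFt by (auto intro: mult_mat_vec_carrier)
  have split: "saddle_mat (E + dE) (F + dF) (G + dG) *\<^sub>v (u @\<^sub>v p)
      = (E *\<^sub>v u + dE *\<^sub>v u + (mat_adjoint F *\<^sub>v p + mat_adjoint dF *\<^sub>v p))
        @\<^sub>v (F *\<^sub>v u + dF *\<^sub>v u + (G *\<^sub>v p + dG *\<^sub>v p))"
    unfolding saddle_mat_def adj
      four_block_mat_mult_vec[OF add_carrier_mat[OF d(1)] add_carrier_mat[OF dFt] add_carrier_mat[OF d(2)] add_carrier_mat[OF d(3)] u p]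
      add_mult_distrib_mat_vec[OF E d(1) u] add_mult_distrib_mat_vec[OF F d(2) u]
      add_mult_distrib_mat_vec[OF G d(3) p] add_mult_distrib_mat_vec[OF Ft dFt p] ..
  have "(dE, dF, dG, dq, dr) \<in> G2_set n m E F G q r u p \<longleftrightarrow>
      dE *\<^sub>v u + mat_adjoint dF *\<^sub>v p - dq = q - E *\<^sub>v u - mat_adjoint F *\<^sub>v p \<and>
      dF *\<^sub>v u + dG *\<^sub>v p - dr = r - F *\<^sub>v u - G *\<^sub>v p"
    using d q r carriers rearrange[OF carriers(1,2,3,4) q d(5)] rearrange[OF carriers(5,6,7,8) r d(6)]
    by (simp add: G2_set_def split append_vec_eq[of _ n])
  thus ?thesis
    using carriers q r d
    by (simp add: perturbation_effect_def real_stack_eq_iff[of _ n _ _ m])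
qed

lemma sps_values_eq:
  assumes q: "q \<in> carrier_vec n" and r: "r \<in> carrier_vec m"
  shows "sps_values n m \<alpha>1 \<alpha>2 \<alpha>3 \<beta>1 \<beta>2 E F G q r u p =
    {zeta \<alpha>1 \<alpha>2 \<alpha>3 \<beta>1 \<beta>2 dE dF dG dq dr | dE dF dG dq dr. sparse_perturbation dE dF dG dq dr \<and>
      perturbation_effect dE dF dG dq dr
        = real_stack (q - E *\<^sub>v u - mat_adjoint F *\<^sub>v p) (r - F *\<^sub>v u - G *\<^sub>v p)}" (is "_ = ?V")
proof
  show "sps_values n m \<alpha>1 \<alpha>2 \<alpha>3 \<beta>1 \<beta>2 E F G q r u p \<subseteq> ?V"
  proof
    fix v assume "v \<in> sps_values n m \<alpha>1 \<alpha>2 \<alpha>3 \<beta>1 \<beta>2 E F G q r u p"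
    then obtain dE dF dG dq dr where
      v: "v = zeta \<alpha>1 \<alpha>2 \<alpha>3 \<beta>1 \<beta>2 (dE \<odot>\<^sub>m Theta E) (dF \<odot>\<^sub>m Theta F) (dG \<odot>\<^sub>m Theta G) dq dr"
      and mem: "(dE \<odot>\<^sub>m Theta E, dF \<odot>\<^sub>m Theta F, dG \<odot>\<^sub>m Theta G, dq, dr) \<in> G2_set n m E F G q r u p"
      by (auto simp: sps_values_def)
    have "sparse_perturbation (dE \<odot>\<^sub>m Theta E) (dF \<odot>\<^sub>m Theta F) (dG \<odot>\<^sub>m Theta G) dq dr"
      using mem sparse_in_hadamard_Theta[OF _ E, of dE] sparse_in_hadamard_Theta[OF _ F, of dF]
        sparse_in_hadamard_Theta[OF _ G, of dG]
      by (simp add: sparse_perturbation_def G2_set_def)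
    thus "v \<in> ?V" using mem v sparse_perturbation_mem_G2_set_iff[OF _ q r] by blast
  qed
  show "?V \<subseteq> sps_values n m \<alpha>1 \<alpha>2 \<alpha>3 \<beta>1 \<beta>2 E F G q r u p"
  proof
    fix v assume "v \<in> ?V"
    then obtain dE dF dG dq dr where v: "v = zeta \<alpha>1 \<alpha>2 \<alpha>3 \<beta>1 \<beta>2 dE dF dG dq dr"
      and pert: "sparse_perturbation dE dF dG dq dr" and mem: "(dE, dF, dG, dq, dr) \<in> G2_set n m E F G q r u p"
      using sparse_perturbation_mem_G2_set_iff[OF _ q r] by blast
    \<comment> \<open>A matrix that obeys the pattern is its own mask and can serve as the unmasked
      witness.\<close>
    have mask: "dE \<odot>\<^sub>m Theta E = dE" "dF \<odot>\<^sub>m Theta F = dF" "dG \<odot>\<^sub>m Theta G = dG"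
      using pert sparse_in_iff_hadamard_Theta[OF _ E, of dE] sparse_in_iff_hadamard_Theta[OF _ F, of dF]
        sparse_in_iff_hadamard_Theta[OF _ G, of dG]
      by (auto simp: sparse_perturbation_def)
    show "v \<in> sps_values n m \<alpha>1 \<alpha>2 \<alpha>3 \<beta>1 \<beta>2 E F G q r u p"
      unfolding sps_values_def mem_Collect_eq
      by (intro exI[of _ dE] exI[of _ dF] exI[of _ dG] exI[of _ dq] exI[of _ dr]) (simp add: mask v mem)
  qed
qed

text \<open>Encoding makes \<open>norm2 x0\<close> a lower bound of all values, decoding
  \<open>x0\<close> shows that it is attained; the infimum is therefore a minimum.\<close>

lemma sps_error_eq:
  assumes q: "q \<in> carrier_vec n" and r: "r \<in> carrier_vec m"
  defines "x0 \<equiv> transpose_mat coeff_M * inv_mat (coeff_M * transpose_mat coeff_M)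
    *\<^sub>v real_stack (q - E *\<^sub>v u - mat_adjoint F *\<^sub>v p) (r - F *\<^sub>v u - G *\<^sub>v p)"
  shows "norm2 x0 \<in> sps_values n m \<alpha>1 \<alpha>2 \<alpha>3 \<beta>1 \<beta>2 E F G q r u p"
    and "sps_error n m \<alpha>1 \<alpha>2 \<alpha>3 \<beta>1 \<beta>2 E F G q r u p = norm2 x0"
proof -
  let ?b = "real_stack (q - E *\<^sub>v u - mat_adjoint F *\<^sub>v p) (r - F *\<^sub>v u - G *\<^sub>v p)"
  let ?V = "sps_values n m \<alpha>1 \<alpha>2 \<alpha>3 \<beta>1 \<beta>2 E F G q r u p"
  have b: "?b \<in> carrier_vec (2 * n + 2 * m)"
    using E F G q r u p mat_adjoint_carrier[OF F]
    by (intro real_stack_carrier minus_carrier_vec mult_mat_vec_carrier)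
  have x0: "x0 \<in> carrier_vec num_cols" "coeff_M *\<^sub>v x0 = ?b"
    "\<And>x. x \<in> carrier_vec num_cols \<Longrightarrow> coeff_M *\<^sub>v x = ?b \<Longrightarrow> norm2 x0 \<le> norm2 x"
    unfolding x0_def
    by (rule least_norm_solution[OF coefficient_mat_carrier coefficient_mat_surj b]; assumption)+
  have lower: "norm2 x0 \<le> v" if v_mem: "v \<in> ?V" for v
  proof -
    obtain dE dF dG dq dr where v: "v = zeta \<alpha>1 \<alpha>2 \<alpha>3 \<beta>1 \<beta>2 dE dF dG dq dr"
      and pert: "sparse_perturbation dE dF dG dq dr" and eff: "perturbation_effect dE dF dG dq dr = ?b"
      using v_mem unfolding sps_values_eq[OF q r] by blast
    obtain x where x: "x \<in> carrier_vec num_cols" "coeff_M *\<^sub>v x = perturbation_effect dE dF dG dq dr"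
      "norm2 x = zeta \<alpha>1 \<alpha>2 \<alpha>3 \<beta>1 \<beta>2 dE dF dG dq dr"
      using pert by (rule encode_perturbation)
    show ?thesis using x0(3)[OF x(1)] x(2,3) eff v by simp
  qed
  obtain dE dF dG dq dr where dec: "sparse_perturbation dE dF dG dq dr"
    "coeff_M *\<^sub>v x0 = perturbation_effect dE dF dG dq dr" "zeta \<alpha>1 \<alpha>2 \<alpha>3 \<beta>1 \<beta>2 dE dF dG dq dr \<le> norm2 x0"
    using x0(1) by (rule decode_perturbation)
  have mem: "zeta \<alpha>1 \<alpha>2 \<alpha>3 \<beta>1 \<beta>2 dE dF dG dq dr \<in> ?V"
    unfolding sps_values_eq[OF q r] using dec(1) dec(2)[unfolded x0(2), symmetric] by blast
  \<comment> \<open>Decoding alone gives only an upper bound by \<open>norm2 x0\<close>; the lower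
    bound, applied to this very value, upgrades it to equality.\<close>
  have "zeta \<alpha>1 \<alpha>2 \<alpha>3 \<beta>1 \<beta>2 dE dF dG dq dr = norm2 x0"
    using lower[OF mem] dec(3) by simp
  with mem show "norm2 x0 \<in> ?V" by simp
  thus "sps_error n m \<alpha>1 \<alpha>2 \<alpha>3 \<beta>1 \<beta>2 E F G q r u p = norm2 x0"
    unfolding sps_error_def using lower by (rule cInf_eq_minimum)
qed

end

theorem theorem3p2:
  fixes n m :: nat
    and E F G :: "complex mat"
    and q r u p :: "complex vec"
    and \<alpha>1 \<alpha>2 \<alpha>3 \<beta>1 \<beta>2 :: real
  assumes "E \<in> carrier_mat n n" and "F \<in> carrier_mat m n" and "G \<in> carrier_mat m m"
    and "hermitian_mat G"
    and "q \<in> carrier_vec n" and "r \<in> carrier_vec m"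
    and "u \<in> carrier_vec n" and "p \<in> carrier_vec m"
    and "invertible_mat (saddle_mat E F G)"
    and "\<alpha>1 > 0" and "\<alpha>2 > 0" and "\<alpha>3 > 0" and "\<beta>1 > 0" and "\<beta>2 > 0"
  shows
    "let Q = q - E *\<^sub>v u - mat_adjoint F *\<^sub>v p;
         R = r - F *\<^sub>v u - G *\<^sub>v p;
         I1 = - (inverse \<beta>1 \<cdot>\<^sub>m 1\<^sub>m (2 * n)) @\<^sub>c 0\<^sub>m (2 * n) (2 * m);
         I2 = 0\<^sub>m (2 * m) (2 * n) @\<^sub>c - (inverse \<beta>2 \<cdot>\<^sub>m 1\<^sub>m (2 * m));
         K1 = K1_hat n \<alpha>1 \<alpha>2 E F u p @\<^sub>c 0\<^sub>m (2 * n) (m\<^sup>2);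
         K2 = 0\<^sub>m (2 * m) (2 * n\<^sup>2) @\<^sub>c K2_hat m \<alpha>2 \<alpha>3 F G u p;
         M = four_block_mat K1 I1 K2 I2
     in invertible_mat (M * transpose_mat M) \<and>
        sps_error n m \<alpha>1 \<alpha>2 \<alpha>3 \<beta>1 \<beta>2 E F G q r u p
          \<in> sps_values n m \<alpha>1 \<alpha>2 \<alpha>3 \<beta>1 \<beta>2 E F G q r u p \<and>
        sps_error n m \<alpha>1 \<alpha>2 \<alpha>3 \<beta>1 \<beta>2 E F G q r u p =
          norm2 (transpose_mat M * inv_mat (M * transpose_mat M)
                   *\<^sub>v (Re_vec Q @\<^sub>v Im_vec Q @\<^sub>v Re_vec R @\<^sub>v Im_vec R))"
proof -
  note data = assms(1-4,7,8,10-14)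
  note err = sps_error_eq[OF data assms(5,6)]
  \<comment> \<open>This conjunct guarantees that \<open>inv_mat\<close> in the formula denotes a
    true inverse and not an unspecified value.\<close>
  have "invertible_mat (coefficient_mat n m \<alpha>1 \<alpha>2 \<alpha>3 \<beta>1 \<beta>2 E F G u p
      * transpose_mat (coefficient_mat n m \<alpha>1 \<alpha>2 \<alpha>3 \<beta>1 \<beta>2 E F G u p))"
    by (rule invertible_gram[OF coefficient_mat_carrier[OF data] coefficient_mat_surj[OF data]])
  thus ?thesis
    using err unfolding Let_def coefficient_mat_def real_stack_def by simp
qed

end
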